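(* There exist absolute constants $C>0$ and $c>0$ such that for all integers $d\ge1$, $1\le s\le cd$, all $\sigma>0$, any $\boldsymbol\theta\in B_0(s,d)$ and any $\boldsymbol\Sigma$ satisfying Assumption $(\varepsilon^*1)$, \[ \mathbf E_{\boldsymbol\theta,\boldsymbol\Sigma}\left[\frac{|\hat\sigma_S^2-\sigma^2|}{\sigma^2}\right]\le C\left(\frac sd+\frac{\|\tilde{\boldsymbol\Sigma}\|_F}{d}\right). \]
   Context: Model: one observes $\boldsymbol Y=\boldsymbol\theta+\sigma\boldsymbol\varepsilon\in\mathbb R^d$, $\boldsymbol\varepsilon\sim\mathcal N(\boldsymbol0,\boldsymbol\Sigma)$, $\boldsymbol\Sigma$ a covariance matrix with known diagonal entries $\sigma_i^2$, $\sigma>0$ unknown; $\mathbf E_{\boldsymbol\theta,\boldsymbol\Sigma}$ is the expectation under this model. $B_0(s,d)=\{\boldsymbol\theta:\|\boldsymbol\theta\|_0\le s\}$. Assumption $(\varepsilon^*1)$: $\min_i\sigma_i^2\ge c_*$ for a constant $c_*>0$. $\tilde Y_i=Y_i/\sigma_i$, $\tilde{\boldsymbol\Sigma}_{ij}=\boldsymbol\Sigma_{ij}/(\sigma_i\sigma_j)$. $\hat F_{Y^2}$ is the empirical c.d.f. of $\tilde Y_1^2,\dots,\tilde Y_d^2$, $F$ the c.d.f. of $\chi^2_1$. For $t>0$, $\hat\sigma_S^2(t)=t/F^{-1}(\hat F_{Y^2}(t))$ if $\hat F_{Y^2}(t)>0$ and $+\infty$ otherwise. Let $\hat t=\min\{t=2^\ell:\ell\in\mathbb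 Z,\ \hat F_{Y^2}(t)\ge0.5\}$ and $\hat\sigma_S^2=\hat\sigma_S^2(\hat t)$. *)

theory Defs
  imports "HOL-Probability.Probability"
begin

text \<open>Matrices and vectors of dimension d are represented as functions on nat,
  only indices below d are relevant.\<close>

definition std_normal :: "real measure" where
  "std_normal = density lborel std_normal_density"

definition is_cov_matrix :: "nat \<Rightarrow> (nat \<Rightarrow> nat \<Rightarrow> real) \<Rightarrow> bool" where
  "is_cov_matrix d S \<longleftrightarrow> (\<forall>i<d. \<forall>j<d. S i j = S j i) \<and>
     (\<forall>x::nat \<Rightarrow> real. 0 \<le> (\<Sum>i<d. \<Sum>j<d. x i * S i j * x j))"

text \<open>A square root factor A with A A^T = S (exists for every covariance matrix).\<close>
definition cov_factor :: "nat \<Rightarrow> (nat \<Rightarrow> nat \<Rightarrow> real) \<Rightarrow> (nat \<Rightarrow> nat \<Rightarrow> real)" where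
  "cov_factor d S = (SOME A. \<forall>i<d. \<forall>j<d. S i j = (\<Sum>k<d. A i k * A j k))"

definition gaussian_vec :: "nat \<Rightarrow> (nat \<Rightarrow> nat \<Rightarrow> real) \<Rightarrow> (nat \<Rightarrow> real) measure" where
  "gaussian_vec d S = distr (PiM {..<d} (\<lambda>_. std_normal)) (PiM {..<d} (\<lambda>_. borel))
     (\<lambda>z. restrict (\<lambda>i. \<Sum>j<d. cov_factor d S i j * z j) {..<d})"

definition l0_norm :: "nat \<Rightarrow> (nat \<Rightarrow> real) \<Rightarrow> nat" where
  "l0_norm d \<theta> = card {i. i < d \<and> \<theta> i \<noteq> 0}"

definition frob_norm_tilde :: "nat \<Rightarrow> (nat \<Rightarrow> nat \<Rightarrow> real) \<Rightarrow> real" where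
  "frob_norm_tilde d S = sqrt (\<Sum>i<d. \<Sum>j<d. (S i j / (sqrt (S i i) * sqrt (S j j)))\<^sup>2)"

definition chi2_1_cdf :: "real \<Rightarrow> real" where
  "chi2_1_cdf x = measure std_normal {z. z\<^sup>2 \<le> x}"

definition chi2_1_quantile :: "real \<Rightarrow> ereal" where
  "chi2_1_quantile p = Inf {ereal x | x. chi2_1_cdf x \<ge> p}"

definition emp_cdf_sq :: "nat \<Rightarrow> (nat \<Rightarrow> nat \<Rightarrow> real) \<Rightarrow> (nat \<Rightarrow> real) \<Rightarrow> real \<Rightarrow> real" where
  "emp_cdf_sq d S Y t = real (card {i. i < d \<and> (Y i / sqrt (S i i))\<^sup>2 \<le> t}) / real d"

definition sigma_S_sq_at :: "nat \<Rightarrow> (nat \<Rightarrow> nat \<Rightarrow> real) \<Rightarrow> (nat \<Rightarrow> real) \<Rightarrow> real \<Rightarrow> ereal" where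
  "sigma_S_sq_at d S Y t =
     (if emp_cdf_sq d S Y t > 0 then ereal t / chi2_1_quantile (emp_cdf_sq d S Y t) else \<infinity>)"

text \<open>t-hat = min of dyadic t = 2^l (l integer) with F-hat(t) >= 1/2. The minimum exists
  almost surely; on the null event where it does not, the Inf of int is unspecified.\<close>
definition t_hat :: "nat \<Rightarrow> (nat \<Rightarrow> nat \<Rightarrow> real) \<Rightarrow> (nat \<Rightarrow> real) \<Rightarrow> real" where
  "t_hat d S Y = 2 powr real_of_int (Inf {l::int. emp_cdf_sq d S Y (2 powr real_of_int l) \<ge> 1/2})"

definition sigma_S_sq :: "nat \<Rightarrow> (nat \<Rightarrow> nat \<Rightarrow> real) \<Rightarrow> (nat \<Rightarrow> real) \<Rightarrow> ereal" where
  "sigma_S_sq d S Y = sigma_S_sq_at d S Y (t_hat d S Y)"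

end

theory Submission
  imports Defs
begin

text \<open>
  For an even function the covariance under a bivariate normal law with correlation \<open>\<rho>\<close> is of order
  \<open>\<rho>\<^sup>2\<close> rather than \<open>\<rho>\<close>. Hence the empirical c.d.f. of the normalised squared noise at level \<open>u\<close>
  deviates from the chi-square c.d.f. by at most a constant times \<open>r / u\<close> in quadratic mean, where
  \<open>r\<close> is the normalised Frobenius norm divided by \<open>d\<close>; sparsity of the mean shifts it by
  at most \<open>s / d\<close>. The quantile function is Lipschitz at bounded levels, so if the dyadic level chosen by the
  estimator is comparable to the noise scale, then the error is controlled by the deviation at one of
  finitely many fixed levels. Choosing a level that is too low or too high by a factor of \<open>2 ^ k\<close> forces a
  deviation of constant order at a fixed level \<open>u\<close>; for the high levels the second moment decays like
  \<open>1 / u\<^sup>2\<close>, which beats the error of order \<open>u\<close> and makes the contributions summable.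
\<close>

text \<open>Let D be the deviation of the empirical c.d.f. of the noise at a level u, and r the
  normalised Frobenius norm divided by d. The stopping level depends on the data but lives on a
  dyadic grid, so a sum over grid levels replaces a maximal inequality. Pairwise correlations give
  only second moments of D, whereas the claim is linear in r. Near the noise scale the error is
  linear in D, and \<open>D <= r / 2 + D^2 / (2 * r)\<close> balances the two. Far above it D is at
  least a constant, so D^2 can be inserted as a factor, and \<open>r <= 1\<close> lowers r^2 to r.
  The order of the covariances comes from regressing one coordinate on the other: conditioning
  shifts a symmetric window, and the first-order effect of the shift cancels. Since only pairs of
  coordinates matter, their joint characteristic functions are all that is computed from the
  Gaussian vector.\<close>

section \<open>Independence from characteristic functions\<close>

text \<open>Joint laws are identified with univariate uniqueness only: first a trigonometric function of one
  variable is the weight, then the indicator of the other variable.\<close>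

lemma (in prob_space) weighted_law_eq:
  fixes X w :: "'a \<Rightarrow> real"
  assumes [measurable]: "random_variable borel X" "random_variable borel w"
    and w: "\<And>x. x \<in> space M \<Longrightarrow> 0 \<le> w x" "\<And>x. x \<in> space M \<Longrightarrow> w x \<le> B"
    and ch: "\<And>u. (\<integral>x. of_real (w x) * iexp (u * X x) \<partial>M) = of_real (expectation w) * (\<integral>x. iexp (u * X x) \<partial>M)"
    and A[measurable]: "A \<in> sets borel"
  shows "expectation (\<lambda>x. w x * indicator A (X x)) = expectation w * prob (X -` A \<inter> space M)"
proof -
  have int_w: "integrable M w"
    using w by (intro integrable_const_bound[of _ B]) auto
  have w_ge0: "0 \<le> expectation w"
    using w by (intro Bochner_Integration.integral_nonneg) auto
  show ?thesis
  proof (cases "expectation w = 0")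
    case True
    then have "AE x in M. w x = 0"
      using integral_nonneg_eq_0_iff_AE[OF int_w] w by (auto intro!: AE_I2)
    then have "expectation (\<lambda>x. w x * indicator A (X x)) = expectation (\<lambda>x. 0)"
      by (intro integral_cong_AE) auto
    then show ?thesis using True by simp
  next
    case False
    define m where "m = expectation w"
    have m: "m > 0" using False w_ge0 by (simp add: m_def)
    \<comment> \<open>Tilting by the normalised weight: \<open>ch\<close> says that \<open>X\<close>
      has the same characteristic function under \<open>N\<close> as under \<open>M\<close>.\<close>
    define N where "N = density M (\<lambda>x. ennreal (w x / m))"
    have wm: "AE x in M. 0 \<le> w x / m" using w m by (auto intro!: AE_I2)
    have emN: "emeasure N S = ennreal (expectation (\<lambda>x. w x / m * indicator S x))" if [measurable]: "S \<in> sets M" for S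
    proof -
      have "emeasure N S = (\<integral>\<^sup>+x. ennreal (w x / m * indicator S x) \<partial>M)"
        unfolding N_def by (subst emeasure_density) (auto intro!: nn_integral_cong simp: indicator_def)
      also have "\<dots> = ennreal (expectation (\<lambda>x. w x / m * indicator S x))"
        using w m by (intro nn_integral_eq_integral integrable_const_bound[of _ "B / m"] AE_I2)
          (auto simp: indicator_def divide_right_mono order.trans[OF w(1) w(2)])
      finally show ?thesis .
    qed
    interpret N: prob_space N
    proof
      have "expectation (\<lambda>x. w x / m * indicator (space M) x) = expectation (\<lambda>x. w x / m)"
        by (intro Bochner_Integration.integral_cong) auto
      then show "emeasure N (space N) = 1"
        using m emN[of "space M"] by (simp add: N_def m_def)
    qed
    have [measurable]: "X \<in> borel_measurable N" by (simp add: N_def)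
    have "distr N borel X = distr M borel X"
    proof (rule Levy_uniqueness)
      show "real_distribution (distr N borel X)" by (rule N.real_distribution_distr) simp
      show "real_distribution (distr M borel X)" by (rule real_distribution_distr) simp
      show "char (distr N borel X) = char (distr M borel X)"
      proof
        fix u
        have "char (distr N borel X) u = (\<integral>x. iexp (u * X x) \<partial>N)"
          unfolding char_def by (subst integral_distr) auto
        also have "\<dots> = (\<integral>x. (w x / m) *\<^sub>R iexp (u * X x) \<partial>M)"
          unfolding N_def using wm by (subst integral_density) auto
        also have "\<dots> = (\<integral>x. of_real (w x) * iexp (u * X x) / of_real m \<partial>M)"
          by (simp add: scaleR_conv_of_real)
        also have "\<dots> = (\<integral>x. of_real (w x) * iexp (u * X x) \<partial>M) / of_real m"
          by simp
        also have "\<dots> = (\<integral>x. iexp (u * X x) \<partial>M)"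
          using m by (subst ch) (simp add: m_def)
        also have "\<dots> = char (distr M borel X) u"
          unfolding char_def by (subst integral_distr) auto
        finally show "char (distr N borel X) u = char (distr M borel X) u" .
      qed
    qed
    then have "measure N (X -` A \<inter> space M) = prob (X -` A \<inter> space M)"
      by (metis A measure_distr N_def \<open>X \<in> borel_measurable N\<close> assms(1) space_density)
    moreover have "measure N (X -` A \<inter> space M) = expectation (\<lambda>x. w x / m * indicator (X -` A \<inter> space M) x)"
      unfolding measure_def using w m by (subst emN) (auto intro!: Bochner_Integration.integral_nonneg)
    moreover have "\<dots> = expectation (\<lambda>x. w x * indicator A (X x) / m)"
      by (intro Bochner_Integration.integral_cong) (auto simp: indicator_def)
    moreover have "\<dots> = expectation (\<lambda>x. w x * indicator A (X x)) / m"
      by simp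
    ultimately show ?thesis using m by (simp add: m_def field_simps)
  qed
qed

lemma iexp_sum: "iexp (a + b) = iexp a * iexp b" for a b :: real
  by (simp add: exp_add distrib_left)

text \<open>The weights in \<open>weighted_law_eq\<close> must be nonnegative, so the complex
  exponential of \<open>V\<close> enters through \<open>1 + cos\<close> and \<open>1 + sin\<close>,
  and the contribution of the summand 1 is subtracted afterwards.\<close>

lemma (in prob_space) indep_var_charI:
  fixes X V :: "'a \<Rightarrow> real"
  assumes [measurable]: "random_variable borel X" "random_variable borel V"
    and ch: "\<And>u v. (\<integral>x. iexp (u * X x + v * V x) \<partial>M) = (\<integral>x. iexp (u * X x) \<partial>M) * (\<integral>x. iexp (v * V x) \<partial>M)"
  shows "indep_var borel X borel V"
proof -
  have int: "integrable M (\<lambda>x. iexp (f x))" if "f \<in> borel_measurable M" for f :: "'a \<Rightarrow> real"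
    using that by (intro integrable_iexp) auto
  have int_bd: "integrable M f" if "f \<in> borel_measurable M" "\<And>x. \<bar>f x\<bar> \<le> 1" for f :: "'a \<Rightarrow> real"
    using that by (intro integrable_const_bound[of _ 1]) auto
  define c where "c v = (\<integral>x. iexp (v * V x) \<partial>M)" for v :: real
  define p where "p u = (\<integral>x. iexp (u * X x) \<partial>M)" for u :: real
  have prod_ch: "(\<integral>x. iexp (v * V x) * iexp (u * X x) \<partial>M) = c v * p u" for u v
    using ch[of u v] unfolding c_def p_def by (simp only: iexp_sum mult.commute)
  have cos_eq: "complex_of_real (cos t) = (iexp t + iexp (- t)) / 2" for t
    by (simp add: cos_exp_eq flip: cos_of_real)
  have sin_eq: "complex_of_real (sin t) = (iexp t - iexp (- t)) / (2 * \<i>)" for t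
    by (simp add: sin_exp_eq flip: sin_of_real)
  have c_cos: "of_real (expectation (\<lambda>x. cos (v * V x))) = (c v + c (- v)) / 2" for v
  proof -
    have "complex_of_real (expectation (\<lambda>x. cos (v * V x))) = (\<integral>x. (iexp (v * V x) + iexp (- v * V x)) / 2 \<partial>M)"
      by (simp only: cos_eq flip: integral_complex_of_real) simp
    then show ?thesis
      using int[of "\<lambda>x. v * V x"] int[of "\<lambda>x. - v * V x"] by (simp add: c_def)
  qed
  have c_sin: "of_real (expectation (\<lambda>x. sin (v * V x))) = (c v - c (- v)) / (2 * \<i>)" for v
  proof -
    have "complex_of_real (expectation (\<lambda>x. sin (v * V x))) = (\<integral>x. (iexp (v * V x) - iexp (- v * V x)) / (2 * \<i>) \<partial>M)"
      by (simp only: sin_eq flip: integral_complex_of_real) simp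
    then show ?thesis
      using int[of "\<lambda>x. v * V x"] int[of "\<lambda>x. - v * V x"] by (simp add: c_def)
  qed
  have int2: "integrable M (\<lambda>x. iexp (v * V x) * iexp (u * X x))" for u v
    using int[of "\<lambda>x. v * V x + u * X x"] by (simp only: iexp_sum) simp
  have E_ind: "expectation (\<lambda>x. indicator A (X x) :: real) = prob (X -` A \<inter> space M)"
    if [measurable]: "A \<in> sets borel" for A
  proof -
    have "expectation (\<lambda>x. indicator A (X x) :: real) = expectation (indicator (X -` A \<inter> space M))"
      by (intro Bochner_Integration.integral_cong) (auto simp: indicator_def)
    also have "\<dots> = prob (X -` A \<inter> space M)"
      by (subst Bochner_Integration.integral_indicator) (auto intro!: arg_cong[where f=prob])
    finally show ?thesis .
  qed
  have E_cos: "expectation (\<lambda>x. cos (v * V x) * indicator A (X x)) = expectation (\<lambda>x. cos (v * V x)) * prob (X -` A \<inter> space M)"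
    if [measurable]: "A \<in> sets borel" for A v
  proof -
    have "expectation (\<lambda>x. (1 + cos (v * V x)) * indicator A (X x)) =
        expectation (\<lambda>x. 1 + cos (v * V x)) * prob (X -` A \<inter> space M)"
    proof (rule weighted_law_eq[where B=2])
      fix u
      have "(\<integral>x. of_real (1 + cos (v * V x)) * iexp (u * X x) \<partial>M) =
          (\<integral>x. iexp (u * X x) + (iexp (v * V x) * iexp (u * X x) + iexp (- v * V x) * iexp (u * X x)) / 2 \<partial>M)"
        by (intro Bochner_Integration.integral_cong) (auto simp: cos_eq ring_distribs add_divide_distrib simp del: cos_of_real)
      also have "\<dots> = p u + (c v * p u + c (- v) * p u) / 2"
        using int[of "\<lambda>x. u * X x"] int2[of v u] int2[of "-v" u] prod_ch[of v u] prod_ch[of "-v" u]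
        by (simp add: p_def[of u])
      also have "\<dots> = of_real (expectation (\<lambda>x. 1 + cos (v * V x))) * p u"
        using c_cos[of v] by (simp add: int_bd prob_space field_simps)
      finally show "(\<integral>x. of_real (1 + cos (v * V x)) * iexp (u * X x) \<partial>M) =
          of_real (expectation (\<lambda>x. 1 + cos (v * V x))) * (\<integral>x. iexp (u * X x) \<partial>M)" by (simp add: p_def)
    next
      show "0 \<le> 1 + cos (v * V x)" for x using cos_ge_minus_one[of "v * V x"] by linarith
      show "1 + cos (v * V x) \<le> 2" for x using cos_le_one[of "v * V x"] by linarith
    qed auto
    moreover have "expectation (\<lambda>x. (1 + cos (v * V x)) * indicator A (X x)) =
        expectation (\<lambda>x. indicator A (X x)) + expectation (\<lambda>x. cos (v * V x) * indicator A (X x))"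
      by (subst Bochner_Integration.integral_add[symmetric]) (auto intro!: int_bd simp: indicator_def ring_distribs)
    moreover have "expectation (\<lambda>x. indicator A (X x) :: real) = prob (X -` A \<inter> space M)"
      by (rule E_ind) simp
    ultimately show ?thesis by (simp add: int_bd prob_space ring_distribs)
  qed
  have E_sin: "expectation (\<lambda>x. sin (v * V x) * indicator A (X x)) = expectation (\<lambda>x. sin (v * V x)) * prob (X -` A \<inter> space M)"
    if [measurable]: "A \<in> sets borel" for A v
  proof -
    have "expectation (\<lambda>x. (1 + sin (v * V x)) * indicator A (X x)) =
        expectation (\<lambda>x. 1 + sin (v * V x)) * prob (X -` A \<inter> space M)"
    proof (rule weighted_law_eq[where B=2])
      fix u
      have "(\<integral>x. of_real (1 + sin (v * V x)) * iexp (u * X x) \<partial>M) =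
          (\<integral>x. iexp (u * X x) + (iexp (v * V x) * iexp (u * X x) - iexp (- v * V x) * iexp (u * X x)) / (2 * \<i>) \<partial>M)"
        by (intro Bochner_Integration.integral_cong) (auto simp: sin_eq ring_distribs diff_divide_distrib mult.assoc simp del: sin_of_real)
      also have "\<dots> = p u + (c v * p u - c (- v) * p u) / (2 * \<i>)"
        using int[of "\<lambda>x. u * X x"] int2[of v u] int2[of "-v" u] prod_ch[of v u] prod_ch[of "-v" u]
        by (simp add: p_def[of u])
      also have "\<dots> = of_real (expectation (\<lambda>x. 1 + sin (v * V x))) * p u"
        by (simp add: c_sin int_bd prob_space ring_distribs diff_divide_distrib mult.assoc)
      finally show "(\<integral>x. of_real (1 + sin (v * V x)) * iexp (u * X x) \<partial>M) =
          of_real (expectation (\<lambda>x. 1 + sin (v * V x))) * (\<integral>x. iexp (u * X x) \<partial>M)" by (simp add: p_def)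
    next
      show "0 \<le> 1 + sin (v * V x)" for x using sin_ge_minus_one[of "v * V x"] by linarith
      show "1 + sin (v * V x) \<le> 2" for x using sin_le_one[of "v * V x"] by linarith
    qed auto
    moreover have "expectation (\<lambda>x. (1 + sin (v * V x)) * indicator A (X x)) =
        expectation (\<lambda>x. indicator A (X x)) + expectation (\<lambda>x. sin (v * V x) * indicator A (X x))"
      by (subst Bochner_Integration.integral_add[symmetric]) (auto intro!: int_bd simp: indicator_def ring_distribs)
    moreover have "expectation (\<lambda>x. indicator A (X x) :: real) = prob (X -` A \<inter> space M)"
      by (rule E_ind) simp
    ultimately show ?thesis by (simp add: int_bd prob_space ring_distribs)
  qed
  have rect: "prob ((X -` A \<inter> space M) \<inter> (V -` B \<inter> space M)) = prob (X -` A \<inter> space M) * prob (V -` B \<inter> space M)"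
    if [measurable]: "A \<in> sets borel" "B \<in> sets borel" for A B
  proof -
    note ind = E_ind[OF that(1)]
    have "expectation (\<lambda>x. indicator A (X x) * indicator B (V x)) = expectation (\<lambda>x. indicator A (X x) :: real) * prob (V -` B \<inter> space M)"
    proof (rule weighted_law_eq[where B=1])
      fix v
      have eq: "of_real (a::real) * iexp t = of_real (cos t * a) + \<i> * of_real (sin t * a)" for a t
        by (simp add: cis_conv_exp[symmetric] complex_eq_iff)
      have "(\<integral>x. of_real (indicator A (X x) :: real) * iexp (v * V x) \<partial>M) =
         (\<integral>x. of_real (cos (v * V x) * indicator A (X x)) + \<i> * of_real (sin (v * V x) * indicator A (X x)) \<partial>M)"
        by (simp only: eq)
      also have "\<dots> = of_real (expectation (\<lambda>x. cos (v * V x) * indicator A (X x))) + \<i> * of_real (expectation (\<lambda>x. sin (v * V x) * indicator A (X x)))"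
        by (subst Bochner_Integration.integral_add)
          (auto intro!: integrable_mult_right integrable_of_real int_bd
            simp: abs_mult indicator_def simp del: of_real_mult cos_of_real sin_of_real)
      also have "\<dots> = of_real (prob (X -` A \<inter> space M)) * ((c v + c (-v)) / 2 + \<i> * ((c v - c (- v)) / (2 * \<i>)))"
        unfolding E_cos[OF that(1)] E_sin[OF that(1)] of_real_mult c_cos c_sin by (simp only: ring_distribs ac_simps)
      also have "(c v + c (-v)) / 2 + \<i> * ((c v - c (- v)) / (2 * \<i>)) = c v"
        by (simp add: field_simps)
      finally show "(\<integral>x. of_real (indicator A (X x) :: real) * iexp (v * V x) \<partial>M) =
          of_real (expectation (\<lambda>x. indicator A (X x))) * (\<integral>x. iexp (v * V x) \<partial>M)" by (simp add: c_def ind)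
    qed (auto simp: indicator_def)
    moreover have "expectation (\<lambda>x. indicator A (X x) * indicator B (V x)) = prob ((X -` A \<inter> space M) \<inter> (V -` B \<inter> space M))"
    proof -
      have "expectation (\<lambda>x. indicator A (X x) * indicator B (V x) :: real) =
          expectation (indicator ((X -` A \<inter> space M) \<inter> (V -` B \<inter> space M)))"
        by (intro Bochner_Integration.integral_cong) (auto simp: indicator_def)
      also have "\<dots> = prob ((X -` A \<inter> space M) \<inter> (V -` B \<inter> space M))"
        by (subst Bochner_Integration.integral_indicator) (auto intro!: arg_cong[where f=prob])
      finally show ?thesis .
    qed
    ultimately show ?thesis by (simp add: ind)
  qed
  show ?thesis
    unfolding indep_var_distribution_eq
  proof (intro conjI)
    interpret DX: prob_space "distr M borel X" by (rule prob_space_distr) simp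
    interpret DV: prob_space "distr M borel V" by (rule prob_space_distr) simp
    show "distr M borel X \<Otimes>\<^sub>M distr M borel V = distr M (borel \<Otimes>\<^sub>M borel) (\<lambda>x. (X x, V x))"
    proof (rule pair_measure_eqI)
      fix A B assume "A \<in> sets (distr M borel X)" "B \<in> sets (distr M borel V)"
      then have [measurable]: "A \<in> sets borel" "B \<in> sets borel" by auto
      have "(\<lambda>x. (X x, V x)) -` (A \<times> B) \<inter> space M = (X -` A \<inter> space M) \<inter> (V -` B \<inter> space M)" by auto
      then show "emeasure (distr M borel X) A * emeasure (distr M borel V) B =
          emeasure (distr M (borel \<Otimes>\<^sub>M borel) (\<lambda>x. (X x, V x))) (A \<times> B)"
        using rect[of A B] by (simp add: emeasure_distr emeasure_eq_measure ennreal_mult)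
    qed (simp_all add: DX.sigma_finite_measure_axioms DV.sigma_finite_measure_axioms cong: sets_pair_measure_cong)
  qed auto
qed

section \<open>Gaussian vectors\<close>

lemma cov_matrix_quadratic_form_nonneg:
  "is_cov_matrix d S \<Longrightarrow> 0 \<le> (\<Sum>i<d. \<Sum>j<d. x i * S i j * x j)"
  by (simp add: is_cov_matrix_def)

text \<open>Minimising the quadratic form over its last coordinate leaves the form of the Schur
  complement, and a minimum of nonnegative values is nonnegative.\<close>

lemma cov_matrix_Schur:
  assumes S: "is_cov_matrix (Suc d) S" and pos: "S d d > 0"
  shows "is_cov_matrix d (\<lambda>i j. S i j - S i d * S j d / S d d)"
  unfolding is_cov_matrix_def
proof (intro conjI allI impI)
  have sym: "S i j = S j i" if "i \<le> d" "j \<le> d" for i j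
    using S that by (auto simp: is_cov_matrix_def less_Suc_eq_le)
  show "S i j - S i d * S j d / S d d = S j i - S j d * S i d / S d d" if "i < d" "j < d" for i j
    using sym[of i j] that by simp
  fix x :: "nat \<Rightarrow> real"
  define b where "b = (\<Sum>i<d. x i * S i d)"
  \<comment> \<open>The last coordinate is the minimiser for given \<open>x\<close>.\<close>
  define y where "y = x(d := - b / S d d)"
  have "0 \<le> (\<Sum>i<Suc d. \<Sum>j<Suc d. y i * S i j * y j)"
    by (rule cov_matrix_quadratic_form_nonneg[OF S])
  also have "\<dots> = (\<Sum>i<d. \<Sum>j<d. x i * S i j * x j) + (\<Sum>i<d. x i * S i d * y d)
      + (\<Sum>j<d. y d * S d j * x j) + y d * S d d * y d"
    by (simp add: sum.distrib sum_negf sum_subtractf y_def)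
  also have "(\<Sum>i<d. x i * S i d * y d) = b * y d"
    by (simp add: b_def sum_distrib_right)
  also have "(\<Sum>j<d. y d * S d j * x j) = y d * b"
    using sym by (simp add: b_def sum_distrib_left ac_simps)
  also have "(\<Sum>i<d. \<Sum>j<d. x i * S i j * x j) + b * y d + y d * b + y d * S d d * y d
      = (\<Sum>i<d. \<Sum>j<d. x i * S i j * x j) - b * b / S d d"
    using pos by (simp add: y_def field_simps)
  also have "b * b / S d d = (\<Sum>i<d. \<Sum>j<d. x i * (S i d * S j d / S d d) * x j)"
    by (simp add: b_def sum_product sum_divide_distrib ac_simps)
  also have "(\<Sum>i<d. \<Sum>j<d. x i * S i j * x j) - \<dots> = (\<Sum>i<d. \<Sum>j<d. x i * (S i j - S i d * S j d / S d d) * x j)"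
    by (simp add: sum_subtractf[symmetric] algebra_simps)
  finally show "0 \<le> (\<Sum>i<d. \<Sum>j<d. x i * (S i j - S i d * S j d / S d d) * x j)" .
qed

lemma cov_matrix_diag_nonneg:
  assumes "is_cov_matrix d S" "k < d"
  shows "0 \<le> S k k"
proof -
  have "0 \<le> (\<Sum>i<d. \<Sum>j<d. (if i = k then 1 else 0) * S i j * (if j = k then 1 else 0))"
    by (rule cov_matrix_quadratic_form_nonneg[OF assms(1)])
  also have "\<dots> = S k k"
    using assms(2) by (simp add: if_distrib[of "\<lambda>x. x * _"] if_distrib[of "\<lambda>x. _ * x"] cong: if_cong)
  finally show ?thesis .
qed

text \<open>Without a square term in coordinate \<open>k\<close>, a nonzero cross term would make
  the form affine in that coordinate and hence unbounded below.\<close>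

lemma cov_matrix_zero_diag:
  assumes S: "is_cov_matrix d S" and k: "k < d" "S k k = 0" and i: "i < d"
  shows "S i k = 0"
proof (rule ccontr)
  assume nz: "S i k \<noteq> 0"
  then have ik: "i \<noteq> k" using k by auto
  \<comment> \<open>Solves \<open>S i i + 2 * a * S i k = -1\<close>.\<close>
  define a where "a = - (S i i + 1) / (2 * S i k)"
  define x :: "nat \<Rightarrow> real" where "x = (\<lambda>j. if j = i then 1 else if j = k then a else 0)"
  have sym: "S k i = S i k" using S k i by (auto simp: is_cov_matrix_def)
  have inner: "(\<Sum>j<d. f j * x j) = f i + a * f k" for f :: "nat \<Rightarrow> real"
  proof -
    have "(\<Sum>j<d. f j * x j) = (\<Sum>j<d. (if j = i then f j else 0) + (if j = k then a * f j else 0))"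
      using ik by (intro sum.cong) (auto simp: x_def)
    then show ?thesis using k i by (simp add: sum.distrib)
  qed
  have "0 \<le> (\<Sum>l<d. \<Sum>j<d. x l * S l j * x j)"
    by (rule cov_matrix_quadratic_form_nonneg[OF S])
  also have "\<dots> = (\<Sum>l<d. (S l i + a * S l k) * x l)"
    by (intro sum.cong refl, subst inner) (simp add: algebra_simps)
  also have "\<dots> = S i i + 2 * a * S i k"
    by (subst inner) (simp add: sym k algebra_simps)
  also have "\<dots> = -1"
    using nz by (simp add: a_def field_simps)
  finally show False by simp
qed

text \<open>Cholesky elimination of the last coordinate. It supplies the witness that gives the
  choice in \<open>cov_factor\<close> its meaning.\<close>

lemma cov_matrix_factor_exists:
  "is_cov_matrix d S \<Longrightarrow> \<exists>A. \<forall>i<d. \<forall>j<d. S i j = (\<Sum>k<d. A i k * A j k)"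
proof (induction d arbitrary: S)
  case 0
  then show ?case by simp
next
  case (Suc d)
  have sym: "S i j = S j i" if "i \<le> d" "j \<le> d" for i j
    using Suc.prems that by (auto simp: is_cov_matrix_def less_Suc_eq_le)
  have nn: "0 \<le> S d d" using cov_matrix_diag_nonneg[OF Suc.prems, of d] by simp
  \<comment> \<open>If \<open>S d d = 0\<close>, division by zero makes the correction vanish, and
    the remaining block is already a covariance matrix.\<close>
  define S' where "S' = (\<lambda>i j. S i j - S i d * S j d / S d d)"
  have "is_cov_matrix d S'"
  proof (cases "S d d = 0")
    case True
    have "0 \<le> (\<Sum>i<d. \<Sum>j<d. x i * S i j * x j)" for x :: "nat \<Rightarrow> real"
    proof -
      have "0 \<le> (\<Sum>i<Suc d. \<Sum>j<Suc d. (x(d := 0)) i * S i j * (x(d := 0)) j)"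
        by (rule cov_matrix_quadratic_form_nonneg[OF Suc.prems])
      then show ?thesis by simp
    qed
    then show ?thesis
      unfolding S'_def is_cov_matrix_def using True sym by (simp add: less_imp_le)
  next
    case False
    then show ?thesis using cov_matrix_Schur[OF Suc.prems] nn by (simp add: S'_def)
  qed
  from Suc.IH[OF this] obtain A where A: "\<And>i j. i < d \<Longrightarrow> j < d \<Longrightarrow> S' i j = (\<Sum>k<d. A i k * A j k)"
    by blast
  \<comment> \<open>The new column carries the rank-one part removed in \<open>S'\<close>; for
    \<open>S d d = 0\<close> it is zero, which agrees with
    \<open>cov_matrix_zero_diag\<close>.\<close>
  define B where "B = (\<lambda>i k. if k = d then S i d / sqrt (S d d) else if i = d then 0 else A i k)"
  have "S i j = (\<Sum>k<Suc d. B i k * B j k)" if "i < Suc d" "j < Suc d" for i j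
  proof -
    have col: "S d d = 0 \<Longrightarrow> l \<le> d \<Longrightarrow> S l d = 0" for l
      using cov_matrix_zero_diag[OF Suc.prems, of d l] by simp
    have last: "B i d * B j d = S i d * S j d / S d d"
      using nn by (simp add: B_def)
    consider "i < d" "j < d" | "i = d" | "j = d" using \<open>i < Suc d\<close> \<open>j < Suc d\<close> by linarith
    then show ?thesis
    proof cases
      case 1
      then have "(\<Sum>k<d. B i k * B j k) = S' i j" by (simp add: A B_def)
      then show ?thesis using last by (simp add: S'_def)
    next
      case 2
      then have "(\<Sum>k<d. B i k * B j k) = 0" by (simp add: B_def)
      then show ?thesis using last 2 col[of j] sym[of j d] that by (cases "S d d = 0") auto
    next
      case 3
      then have "(\<Sum>k<d. B i k * B j k) = 0" by (simp add: B_def)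
      then show ?thesis using last 3 col[of i] sym[of i d] that by (cases "S d d = 0") auto
    qed
  qed
  then show ?case by blast
qed

lemma cov_factor_eq:
  assumes "is_cov_matrix d S" "i < d" "j < d"
  shows "S i j = (\<Sum>k<d. cov_factor d S i k * cov_factor d S j k)"
  using someI_ex[OF cov_matrix_factor_exists[OF assms(1)], folded cov_factor_def] assms(2,3) by blast

lemma cov_matrix_Cauchy_Schwarz:
  assumes "is_cov_matrix d S" "i < d" "j < d"
  shows "(S i j)\<^sup>2 \<le> S i i * S j j"
  using Cauchy_Schwarz_ineq_sum[of "cov_factor d S i" "cov_factor d S j" "{..<d}"]
  by (simp add: cov_factor_eq[OF assms(1)] assms(2,3) power2_eq_square)

section \<open>Characteristic functions of pairs of Gaussian coordinates\<close>

lemma prob_space_std_normal: "prob_space std_normal"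
  unfolding std_normal_def by (rule prob_space_normal_density) simp

lemma sets_std_normal [measurable_cong, simp]: "sets std_normal = sets borel"
  and space_std_normal [simp]: "space std_normal = UNIV"
  by (simp_all add: std_normal_def)

lemma char_std_normal: "(\<integral>x. iexp (t * x) \<partial>std_normal) = complex_of_real (exp (- t\<^sup>2 / 2))"
  using char_std_normal_distribution by (simp add: char_def std_normal_def fun_eq_iff)

lemma prob_space_gaussian_vec: "prob_space (gaussian_vec d S)"
proof -
  interpret prob_space std_normal by (rule prob_space_std_normal)
  interpret product_prob_space "\<lambda>_. std_normal" "{..<d}" ..
  show ?thesis
    unfolding gaussian_vec_def by (rule P.prob_space_distr) simp
qed

lemma sets_gaussian_vec [measurable_cong, simp]:
    "sets (gaussian_vec d S) = sets (PiM {..<d} (\<lambda>_. borel :: real measure))"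
  and space_gaussian_vec [simp]: "space (gaussian_vec d S) = space (PiM {..<d} (\<lambda>_. borel :: real measure))"
  by (simp_all add: gaussian_vec_def)

text \<open>A combination of two coordinates is a linear form in independent standard normals: the
  integral factorises, and the squared coefficients add up to the variance. The case
  \<open>i = j\<close> is included.\<close>

lemma char_gaussian_vec_coordinates:
  assumes S: "is_cov_matrix d S" and ij: "i < d" "j < d"
  shows "(\<integral>e. iexp (u * e i + v * e j) \<partial>gaussian_vec d S) =
    complex_of_real (exp (- (u\<^sup>2 * S i i + v\<^sup>2 * S j j + 2 * u * v * S i j) / 2))"
proof -
  interpret prob_space std_normal by (rule prob_space_std_normal)
  interpret product_prob_space "\<lambda>_. std_normal" "{..<d}" ..
  define b where "b = (\<lambda>k. u * cov_factor d S i k + v * cov_factor d S j k)"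
  have "(\<integral>e. iexp (u * e i + v * e j) \<partial>gaussian_vec d S) =
     (\<integral>z. iexp (\<Sum>k<d. b k * z k) \<partial>PiM {..<d} (\<lambda>_. std_normal))"
    unfolding gaussian_vec_def using ij
    by (subst integral_distr) (auto simp: b_def sum_distrib_left sum.distrib ring_distribs ac_simps)
  also have "\<dots> = (\<integral>z. (\<Prod>k<d. iexp (b k * z k)) \<partial>PiM {..<d} (\<lambda>_. std_normal))"
    by (simp add: exp_sum sum_distrib_left)
  also have "\<dots> = (\<Prod>k<d. \<integral>x. iexp (b k * x) \<partial>std_normal)"
    by (rule product_integral_prod) (simp_all add: prob_space.integrable_iexp[OF prob_space_std_normal])
  also have "\<dots> = (\<Prod>k<d. complex_of_real (exp (- (b k)\<^sup>2 / 2)))"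
    by (simp only: char_std_normal)
  also have "\<dots> = complex_of_real (exp (- (\<Sum>k<d. (b k)\<^sup>2) / 2))"
    by (simp add: exp_sum sum_divide_distrib sum_negf[symmetric] flip: of_real_prod)
  also have "(\<Sum>k<d. (b k)\<^sup>2) = u\<^sup>2 * S i i + v\<^sup>2 * S j j + 2 * u * v * S i j"
    unfolding cov_factor_eq[OF S ij(1) ij(1)] cov_factor_eq[OF S ij(2) ij(2)] cov_factor_eq[OF S ij]
    by (simp add: b_def sum_distrib_left sum.distrib[symmetric] power2_eq_square algebra_simps)
  finally show ?thesis .
qed

section \<open>The standard normal and chi-square distributions\<close>

lemma std_normal_density_le_half: "std_normal_density x \<le> 1 / 2"
proof -
  have "2 \<le> sqrt (2 * pi)"
    using pi_gt3 by (intro real_le_rsqrt) (simp add: power2_eq_square)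
  then have "1 / sqrt (2 * pi) \<le> 1 / 2" by (intro divide_left_mono) auto
  moreover have "exp (- x\<^sup>2 / 2) \<le> 1" by simp
  ultimately have "(1 / sqrt (2 * pi)) * exp (- x\<^sup>2 / 2) \<le> (1 / 2) * 1" by (intro mult_mono) auto
  then show ?thesis by (simp add: std_normal_density_def)
qed

lemma std_normal_density_deriv:
  "(std_normal_density has_real_derivative - x * std_normal_density x) (at x within A)"
proof -
  have "((\<lambda>x. exp (- x\<^sup>2 / 2)) has_real_derivative - x * exp (- x\<^sup>2 / 2)) (at x within A)"
    by (auto intro!: derivative_eq_intros)
  from DERIV_cmult[OF this, of "1 / sqrt (2 * pi)"] show ?thesis
    unfolding std_normal_density_def[abs_def] by (simp add: ac_simps)
qed

lemma continuous_on_std_normal_density: "continuous_on A std_normal_density"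
  by (rule DERIV_continuous_on) (rule std_normal_density_deriv)

text \<open>The derivative is bounded by 1 because
  \<open>|x| <= 1 + x^2 / 2 <= exp (x^2 / 2)\<close>.\<close>

lemma std_normal_density_lipschitz:
  "\<bar>std_normal_density x - std_normal_density y\<bar> \<le> \<bar>x - y\<bar>"
proof -
  have "norm (std_normal_density x - std_normal_density y) \<le> 1 * norm (x - y)"
  proof (rule field_differentiable_bound[where S=UNIV and f'="\<lambda>x. - x * std_normal_density x"])
    fix z :: real
    have "\<bar>z\<bar> * std_normal_density z = \<bar>z\<bar> * exp (- z\<^sup>2 / 2) * (1 / sqrt (2 * pi))"
      by (simp add: std_normal_density_def)
    also have "\<dots> \<le> 1 * 1"
    proof (intro mult_mono)
      have "0 \<le> (\<bar>z\<bar> - 1)\<^sup>2" by simp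
      then have "\<bar>z\<bar> \<le> 1 + z\<^sup>2 / 2" by (simp add: power2_eq_square algebra_simps)
      also have "\<dots> \<le> exp (z\<^sup>2 / 2)" by (rule exp_ge_add_one_self)
      finally show "\<bar>z\<bar> * exp (- z\<^sup>2 / 2) \<le> 1"
        by (simp add: exp_minus field_simps)
      show "1 / sqrt (2 * pi) \<le> 1"
        using pi_gt3 by simp
    qed auto
    finally show "norm (- z * std_normal_density z) \<le> 1"
      by (simp add: abs_mult)
  qed (use std_normal_density_deriv in auto)
  then show ?thesis by simp
qed

lemma measure_std_normal_singleton: "measure std_normal {c} = 0"
  and emeasure_std_normal_singleton: "emeasure std_normal {c} = 0"
proof -
  have "{c} \<in> null_sets lborel" by (simp add: null_sets_def)
  then show "emeasure std_normal {c} = 0"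
    unfolding std_normal_def by (subst emeasure_density) (auto simp: nn_integral_null_set)
  then show "measure std_normal {c} = 0" by (simp add: measure_def)
qed

lemma measure_std_normal_Icc: "measure std_normal {a..b} = integral {a..b} std_normal_density"
proof -
  have int: "integrable lborel (\<lambda>x. indicator {a..b} x *\<^sub>R std_normal_density x)"
    using integrable_mult_indicator[OF _ integrable_std_normal_moment[of 0], of "{a..b}"] by simp
  have "emeasure std_normal {a..b} = (\<integral>\<^sup>+x. ennreal (indicator {a..b} x *\<^sub>R std_normal_density x) \<partial>lborel)"
    unfolding std_normal_def by (subst emeasure_density) (auto intro!: nn_integral_cong simp: indicator_def)
  also have "\<dots> = ennreal (\<integral>x. indicator {a..b} x *\<^sub>R std_normal_density x \<partial>lborel)"
    using int by (intro nn_integral_eq_integral) auto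
  finally have "measure std_normal {a..b} = (LINT x:{a..b}|lborel. std_normal_density x)"
    by (simp add: measure_def set_lebesgue_integral_def)
  also have "\<dots> = integral {a..b} std_normal_density"
    using int by (intro set_borel_integral_eq_integral) (simp add: set_integrable_def)
  finally show ?thesis .
qed

lemma measure_std_normal_Icc_cdf:
  assumes "a \<le> b"
  shows "measure std_normal {a..b} = measure std_normal {..b} - measure std_normal {..a}"
proof -
  interpret prob_space std_normal by (rule prob_space_std_normal)
  have "measure std_normal {..b} = measure std_normal ({..<a} \<union> {a..b})"
    using assms by (intro arg_cong[where f="measure std_normal"]) auto
  also have "\<dots> = measure std_normal {..<a} + measure std_normal {a..b}"
    by (intro finite_measure_Union) auto
  finally have b: "measure std_normal {..b} = measure std_normal {..<a} + measure std_normal {a..b}" .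
  have "measure std_normal {..a} = measure std_normal ({..<a} \<union> {a})"
    by (intro arg_cong[where f="measure std_normal"]) auto
  also have "\<dots> = measure std_normal {..<a}"
    by (subst finite_measure_Union) (auto simp: measure_std_normal_singleton)
  finally show ?thesis using b by simp
qed

lemma std_normal_cdf_deriv:
  "((\<lambda>x. measure std_normal {..x}) has_real_derivative std_normal_density x) (at x)"
proof -
  have "((\<lambda>y. measure std_normal {..x - 1} + integral {x - 1..y} std_normal_density)
      has_real_derivative std_normal_density x) (at x within {x - 1..x + 1})"
    using integral_has_real_derivative[OF continuous_on_std_normal_density, of x "x - 1" "x + 1"]
    by (auto intro!: derivative_eq_intros)
  then have "((\<lambda>y. measure std_normal {..y}) has_real_derivative std_normal_density x) (at x within {x - 1..x + 1})"
    unfolding has_field_derivative_def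
    by (rule has_derivative_transform[rotated -1])
      (auto simp: measure_std_normal_Icc[symmetric] measure_std_normal_Icc_cdf)
  then show ?thesis
    by (simp add: at_within_Icc_at)
qed

text \<open>The window is symmetric about 0, so moving its centre is only a second-order effect.\<close>

lemma std_normal_shifted_window:
  assumes b: "0 \<le> b"
  shows "\<bar>measure std_normal {- b - \<delta>..b - \<delta>} - measure std_normal {- b..b}\<bar> \<le> 2 * \<delta>\<^sup>2"
proof -
  define J where "J s = measure std_normal {..b - s} - measure std_normal {..- b - s}" for s
  have J: "measure std_normal {- b - s..b - s} = J s" for s
    using b by (simp add: J_def measure_std_normal_Icc_cdf)
  have sym: "std_normal_density (- x) = std_normal_density x" for x
    by (simp add: std_normal_density_def)
  have "norm (J \<delta> - J 0) \<le> (2 * \<bar>\<delta>\<bar>) * norm (\<delta> - 0)"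
  \<comment> \<open>By evenness the derivative of \<open>J\<close> is a difference of densities at
    two points whose distance is at most \<open>2 * |\<delta>|\<close>, up to reflection.\<close>
  proof (rule field_differentiable_bound[where S="{-\<bar>\<delta>\<bar>..\<bar>\<delta>\<bar>}" and f'="\<lambda>s. std_normal_density (b + s) - std_normal_density (b - s)"])
    fix s assume s: "s \<in> {-\<bar>\<delta>\<bar>..\<bar>\<delta>\<bar>}"
    have 1: "((\<lambda>s. measure std_normal {..c - s}) has_real_derivative - std_normal_density (c - s)) (at s)" for c
    proof -
      have "((\<lambda>s. c - s) has_real_derivative -1) (at s)" by (auto intro!: derivative_eq_intros)
      from DERIV_chain2[OF std_normal_cdf_deriv this] show ?thesis by simp
    qed
    show "(J has_field_derivative std_normal_density (b + s) - std_normal_density (b - s)) (at s within {-\<bar>\<delta>\<bar>..\<bar>\<delta>\<bar>})"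
      unfolding J_def[abs_def]
      using DERIV_diff[OF 1[of b] 1[of "-b"]] sym[of "b + s"]
      by (auto intro!: DERIV_subset[where s=UNIV] simp: algebra_simps)
    show "norm (std_normal_density (b + s) - std_normal_density (b - s)) \<le> 2 * \<bar>\<delta>\<bar>"
      using std_normal_density_lipschitz[of "b + s" "b - s"] s by auto
  qed auto
  then have "\<bar>J \<delta> - J 0\<bar> \<le> 2 * \<delta>\<^sup>2"
    by (simp add: power2_eq_square)
  then show ?thesis using J[of \<delta>] J[of 0] by simp
qed

section \<open>The chi-square c.d.f. as a normal window, and its tail\<close>

lemma sq_le_iff_Icc: "0 \<le> t \<Longrightarrow> z\<^sup>2 \<le> t \<longleftrightarrow> z \<in> {- sqrt t..sqrt t}" for z t :: real
  by (metis abs_le_iff atLeastAtMost_iff minus_le_iff real_sqrt_abs real_sqrt_le_iff)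

lemma chi2_1_cdf_Icc: "0 \<le> t \<Longrightarrow> chi2_1_cdf t = measure std_normal {- sqrt t..sqrt t}"
  unfolding chi2_1_cdf_def by (intro arg_cong[where f="measure std_normal"]) (auto simp: sq_le_iff_Icc)

lemma chi2_1_cdf_nonneg: "0 \<le> chi2_1_cdf t"
  by (simp add: chi2_1_cdf_def)

lemma chi2_1_cdf_le_1: "chi2_1_cdf t \<le> 1"
  unfolding chi2_1_cdf_def by (rule prob_space.prob_le_1[OF prob_space_std_normal])

text \<open>The fourth moment comes from the tail bound, the second from the shift of a window, and
  the sixth from the product of the two.\<close>

lemma std_normal_moments:
  "(\<integral>x. x^2 \<partial>std_normal) = 1" "integrable std_normal (\<lambda>x. x^2)"
  "(\<integral>x. x^4 \<partial>std_normal) = 3" "integrable std_normal (\<lambda>x. x^4)"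
  "(\<integral>x. x^6 \<partial>std_normal) = 15" "integrable std_normal (\<lambda>x. x^6)"
  using std_normal_distribution_even_moments[of 1] std_normal_distribution_even_moments[of 2]
    std_normal_distribution_even_moments[of 3]
  by (simp_all add: std_normal_def fact_numeral)

text \<open>Markov's inequality with the fourth power of \<open>x\<close> instead of the square: a
  decay of only \<open>1 / t\<close> would exactly cancel the later factor \<open>2 ^ k\<close> and
  leave a divergent series.\<close>

lemma indicator_sq_gt_le: "0 < t \<Longrightarrow> 1 - indicator {z. z\<^sup>2 \<le> t} x \<le> x^4 / t\<^sup>2" for x t :: real
proof -
  assume t: "0 < t"
  show ?thesis
  proof (cases "x\<^sup>2 \<le> t")
    case False
    then have "t\<^sup>2 \<le> (x\<^sup>2)\<^sup>2" using t by (intro power_mono) auto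
    then show ?thesis using False t by (simp add: field_simps flip: power_mult)
  qed simp
qed

lemma borel_sq_le [measurable, simp]: "{z. z\<^sup>2 \<le> t} \<in> sets borel" for t :: real
  by measurable

lemma chi2_1_cdf_integral: "chi2_1_cdf t = (\<integral>x. indicator {z. z\<^sup>2 \<le> t} x \<partial>std_normal)"
  by (simp add: chi2_1_cdf_def)

lemma chi2_1_cdf_tail:
  assumes t: "0 < t"
  shows "1 - chi2_1_cdf t \<le> 3 / t\<^sup>2"
proof -
  interpret prob_space std_normal by (rule prob_space_std_normal)
  have [simp]: "integrable std_normal (indicator {z. z\<^sup>2 \<le> t} :: real \<Rightarrow> real)"
    by (intro integrable_const_bound[of _ 1]) auto
  have "1 - chi2_1_cdf t = (\<integral>x. 1 - indicator {z. z\<^sup>2 \<le> t} x \<partial>std_normal)"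
    unfolding chi2_1_cdf_integral by (subst Bochner_Integration.integral_diff) (auto simp: prob_space[simplified])
  also have "\<dots> \<le> (\<integral>x. x^4 / t\<^sup>2 \<partial>std_normal)"
    using indicator_sq_gt_le[OF t] std_normal_moments(4) by (intro integral_mono) auto
  also have "\<dots> = 3 / t\<^sup>2" by (simp add: std_normal_moments)
  finally show ?thesis .
qed

section \<open>Covariance of squared coordinates\<close>

lemma (in prob_space) distr_std_normalI:
  fixes X :: "'a \<Rightarrow> real"
  assumes [measurable]: "random_variable borel X"
    and ch: "\<And>u. (\<integral>x. iexp (u * X x) \<partial>M) = of_real (exp (- u\<^sup>2 / 2))"
  shows "distr M borel X = std_normal"
proof (rule Levy_uniqueness)
  show "real_distribution (distr M borel X)" by (rule real_distribution_distr) simp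
  show "real_distribution std_normal" unfolding std_normal_def by (rule real_dist_normal_dist)
  show "char (distr M borel X) = char std_normal"
    unfolding char_def by (rule ext, subst integral_distr) (simp_all only: char_std_normal ch, simp_all)
qed

text \<open>Write \<open>Y = \<rho> * X + \<tau> * V\<close> with \<open>V\<close> independent of
  \<open>X\<close>. Integrating out \<open>V\<close> turns \<open>f (Y)\<close> into
  \<open>h (X)\<close>, a window shifted in proportion to \<open>\<rho> * X\<close>; the tail bound
  on the factor \<open>f (X)\<close> supplies \<open>1 / t^2\<close>. The constant 54 covers the 24
  needed for strong correlation and the 48 for weak correlation.\<close>

lemma (in prob_space) cov_sq_le_indicators:
  fixes X Y :: "'a \<Rightarrow> real"
  assumes [measurable]: "random_variable borel X" "random_variable borel Y"
    and ch: "\<And>u v. (\<integral>x. iexp (u * X x + v * Y x) \<partial>M) = of_real (exp (- (u\<^sup>2 + v\<^sup>2 + 2 * u * v * \<rho>) / 2))"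
    and t: "0 < t"
  defines "f \<equiv> \<lambda>z. indicator {z. z\<^sup>2 \<le> t} z - chi2_1_cdf t"
  shows "\<bar>expectation (\<lambda>x. f (X x) * f (Y x))\<bar> \<le> 54 * \<rho>\<^sup>2 / t\<^sup>2"
proof -
  interpret N: prob_space std_normal by (rule prob_space_std_normal)
  have f_meas[measurable]: "f \<in> borel_measurable borel" unfolding f_def by measurable
  have f_bd: "\<bar>f z\<bar> \<le> 1" for z
    using chi2_1_cdf_nonneg[of t] chi2_1_cdf_le_1[of t] by (auto simp: f_def indicator_def)
  have f_tail: "\<bar>f z\<bar> \<le> (z^4 + 3) / t\<^sup>2" for z
  proof -
    have "\<bar>f z\<bar> \<le> (1 - indicator {z. z\<^sup>2 \<le> t} z) + (1 - chi2_1_cdf t)"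
      using chi2_1_cdf_nonneg[of t] chi2_1_cdf_le_1[of t] by (auto simp: f_def indicator_def)
    also have "\<dots> \<le> z^4 / t\<^sup>2 + 3 / t\<^sup>2"
      by (intro add_mono indicator_sq_gt_le chi2_1_cdf_tail t)
    finally show ?thesis by (simp add: add_divide_distrib)
  qed
  have int_f: "integrable std_normal (\<lambda>z. f (a + c * z))" for a c
    using f_bd by (intro N.integrable_const_bound[of _ 1]) auto
  have int_f0: "integrable std_normal f" using int_f[of 0 1] by simp
  have mean_f: "(\<integral>z. f z \<partial>std_normal) = 0"
  proof -
    have "integrable std_normal (indicator {z. z\<^sup>2 \<le> t} :: real \<Rightarrow> real)"
      by (intro N.integrable_const_bound[of _ 1]) auto
    then show ?thesis
      unfolding f_def by (simp add: chi2_1_cdf_integral N.prob_space[simplified])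
  qed
  have X_law: "distr M borel X = std_normal"
    using ch[of _ 0] by (intro distr_std_normalI) auto
  show ?thesis
  \<comment> \<open>For strong correlation the first moment of \<open>|f|\<close> is already of the
    required order; otherwise \<open>\<tau>^2 >= 3 / 4\<close> keeps the division by
    \<open>\<tau>\<close> harmless.\<close>
  proof (cases "\<bar>\<rho>\<bar> \<le> 1 / 2")
    case False
    have "\<bar>expectation (\<lambda>x. f (X x) * f (Y x))\<bar> \<le> expectation (\<lambda>x. \<bar>f (X x) * f (Y x)\<bar>)"
      by (rule integral_abs_bound)
    also have "\<dots> \<le> expectation (\<lambda>x. \<bar>f (X x)\<bar>)"
      using f_bd by (intro integral_mono integrable_const_bound[of _ 1] AE_I2)
        (auto simp: abs_mult mult_le_one intro: mult_left_le)
    also have "\<dots> = (\<integral>z. \<bar>f z\<bar> \<partial>std_normal)"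
      unfolding X_law[symmetric] by (subst integral_distr) auto
    also have "\<dots> \<le> (\<integral>z. (z^4 + 3) / t\<^sup>2 \<partial>std_normal)"
      using int_f0 f_tail by (intro integral_mono) (auto simp: std_normal_moments)
    also have "\<dots> = 6 / t\<^sup>2"
      by (simp add: std_normal_moments N.prob_space[simplified])
    also have "\<dots> \<le> 54 * \<rho>\<^sup>2 / t\<^sup>2"
    proof -
      have "(1 / 2)\<^sup>2 \<le> \<bar>\<rho>\<bar>\<^sup>2" using False by (intro power_mono) auto
      then show ?thesis by (intro divide_right_mono) (auto simp: power2_eq_square)
    qed
    finally show ?thesis .
  next
    case True
    have \<rho>2: "\<rho>\<^sup>2 \<le> 1 / 4"
      using power_mono[OF True, of 2] by (simp add: power2_eq_square)
    define \<tau> where "\<tau> = sqrt (1 - \<rho>\<^sup>2)"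
    have \<tau>2: "\<tau>\<^sup>2 = 1 - \<rho>\<^sup>2" and \<tau>: "0 < \<tau>" using \<rho>2 by (auto simp: \<tau>_def)
    \<comment> \<open>Standardised residual of the regression of \<open>Y\<close> on
      \<open>X\<close>.\<close>
    define V where "V x = (Y x - \<rho> * X x) / \<tau>" for x
    have [measurable]: "random_variable borel V" unfolding V_def[abs_def] by measurable
    have ch_XV: "(\<integral>x. iexp (u * X x + v * V x) \<partial>M) = of_real (exp (- (u\<^sup>2 + v\<^sup>2) / 2))" for u v
    proof -
      have "(\<integral>x. iexp (u * X x + v * V x) \<partial>M) = (\<integral>x. iexp ((u - v * \<rho> / \<tau>) * X x + (v / \<tau>) * Y x) \<partial>M)"
        by (intro Bochner_Integration.integral_cong refl arg_cong[where f=iexp]) (use \<tau> in \<open>simp add: V_def field_simps\<close>)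
      also have "\<dots> = of_real (exp (- ((u - v * \<rho> / \<tau>)\<^sup>2 + (v / \<tau>)\<^sup>2 + 2 * (u - v * \<rho> / \<tau>) * (v / \<tau>) * \<rho>) / 2))"
        by (rule ch)
      also have "(u - v * \<rho> / \<tau>)\<^sup>2 + (v / \<tau>)\<^sup>2 + 2 * (u - v * \<rho> / \<tau>) * (v / \<tau>) * \<rho> = u\<^sup>2 + v\<^sup>2 * (1 - \<rho>\<^sup>2) / \<tau>\<^sup>2"
        using \<tau> by (simp add: field_simps power2_eq_square)
      also have "\<dots> = u\<^sup>2 + v\<^sup>2" using \<tau> by (simp add: \<tau>2[symmetric])
      finally show ?thesis .
    qed
    have V_law: "distr M borel V = std_normal"
      using ch_XV[of 0] by (intro distr_std_normalI) auto
    have "indep_var borel X borel V"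
    proof (rule indep_var_charI)
      fix u v
      have X: "(\<integral>x. iexp (u * X x) \<partial>M) = of_real (exp (- u\<^sup>2 / 2))"
        using ch_XV[of u 0] by simp
      have V: "(\<integral>x. iexp (v * V x) \<partial>M) = of_real (exp (- v\<^sup>2 / 2))"
        using ch_XV[of 0 v] by simp
      show "(\<integral>x. iexp (u * X x + v * V x) \<partial>M) = (\<integral>x. iexp (u * X x) \<partial>M) * (\<integral>x. iexp (v * V x) \<partial>M)"
        unfolding ch_XV X V of_real_mult[symmetric] exp_add[symmetric] by (simp add: diff_divide_distrib)
    qed auto
    then have XV_law: "distr M (borel \<Otimes>\<^sub>M borel) (\<lambda>x. (X x, V x)) = std_normal \<Otimes>\<^sub>M std_normal"
      by (simp add: indep_var_distribution_eq X_law V_law)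
    interpret NN: pair_prob_space std_normal std_normal ..
    define b where "b = sqrt t / \<tau>"
    have b: "0 \<le> b" using t \<tau> by (simp add: b_def)
    define h where "h x = (\<integral>v. f (\<rho> * x + \<tau> * v) \<partial>std_normal)" for x
    have h: "h x = measure std_normal {- b - \<rho> * x / \<tau>..b - \<rho> * x / \<tau>} - chi2_1_cdf t" for x
    proof -
      have eq: "(\<rho> * x + \<tau> * v)\<^sup>2 \<le> t \<longleftrightarrow> v \<in> {- b - \<rho> * x / \<tau>..b - \<rho> * x / \<tau>}" for v
        using t \<tau> by (auto simp: sq_le_iff_Icc b_def field_simps)
      have "f (\<rho> * x + \<tau> * v) = indicator {- b - \<rho> * x / \<tau>..b - \<rho> * x / \<tau>} v - chi2_1_cdf t" for v
        unfolding f_def indicator_def mem_Collect_eq eq by simp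
      moreover have "integrable std_normal (indicator {- b - \<rho> * x / \<tau>..b - \<rho> * x / \<tau>} :: real \<Rightarrow> real)"
        by (intro N.integrable_const_bound[of _ 1]) auto
      ultimately show ?thesis by (simp add: h_def N.prob_space[simplified])
    qed
    have [measurable]: "h \<in> borel_measurable borel" unfolding h_def[abs_def] by measurable
    have h_diff: "\<bar>h x - h 0\<bar> \<le> 8 / 3 * \<rho>\<^sup>2 * x\<^sup>2" for x
    proof -
      have "\<bar>h x - h 0\<bar> \<le> 2 * (\<rho> * x / \<tau>)\<^sup>2"
        using std_normal_shifted_window[OF b, of "\<rho> * x / \<tau>"] by (simp add: h)
      also have "\<dots> = (2 * \<rho>\<^sup>2 * x\<^sup>2) / \<tau>\<^sup>2" by (simp add: power_mult_distrib power_divide)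
      also have "\<dots> \<le> (2 * \<rho>\<^sup>2 * x\<^sup>2) / (3 / 4)"
        using \<rho>2 by (intro divide_left_mono) (auto simp: \<tau>2)
      finally show ?thesis by (simp add: ac_simps)
    qed
    have h_bd: "\<bar>h x\<bar> \<le> 1" for x
      using chi2_1_cdf_nonneg[of t] chi2_1_cdf_le_1[of t] N.prob_le_1[of "{- b - \<rho> * x / \<tau>..b - \<rho> * x / \<tau>}"]
        measure_nonneg[of std_normal "{- b - \<rho> * x / \<tau>..b - \<rho> * x / \<tau>}"]
      unfolding h by linarith
    have int_fh: "integrable std_normal (\<lambda>x. f x * h x)"
      using f_bd h_bd by (intro N.integrable_const_bound[of _ 1]) (auto simp: abs_mult intro!: mult_le_one)
    have int_pair: "integrable (std_normal \<Otimes>\<^sub>M std_normal) (\<lambda>(x, v). f x * f (\<rho> * x + \<tau> * v))"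
      using f_bd by (intro NN.integrable_const_bound[of _ 1] AE_I2) (auto simp: abs_mult intro!: mult_le_one split: prod.split)
    have "expectation (\<lambda>x. f (X x) * f (Y x)) = expectation (\<lambda>x. (\<lambda>(x, v). f x * f (\<rho> * x + \<tau> * v)) (X x, V x))"
      using \<tau> by (intro Bochner_Integration.integral_cong) (auto simp: V_def)
    also have "\<dots> = (\<integral>p. (\<lambda>(x, v). f x * f (\<rho> * x + \<tau> * v)) p \<partial>(std_normal \<Otimes>\<^sub>M std_normal))"
      unfolding XV_law[symmetric] by (subst integral_distr) auto
    also have "\<dots> = (\<integral>x. (\<integral>v. f x * f (\<rho> * x + \<tau> * v) \<partial>std_normal) \<partial>std_normal)"
      using NN.integral_fst[OF int_pair] by simp
    also have "\<dots> = (\<integral>x. f x * h x \<partial>std_normal)"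
      by (simp add: h_def)
    \<comment> \<open>As \<open>f\<close> has mean zero, the constant \<open>h 0\<close> may be
      subtracted, which leaves only the second-order effect of the shift.\<close>
    also have "\<dots> = (\<integral>x. f x * (h x - h 0) \<partial>std_normal)"
      using int_fh int_f0 mean_f by (simp add: right_diff_distrib)
    finally have "\<bar>expectation (\<lambda>x. f (X x) * f (Y x))\<bar> \<le> (\<integral>x. \<bar>f x * (h x - h 0)\<bar> \<partial>std_normal)"
      by (simp only:) (rule integral_abs_bound)
    \<comment> \<open>The tail bound is spent on \<open>f\<close>, the shift bound on
      \<open>h\<close>; the moments give \<open>8 / 3 * (15 + 3) = 48\<close>.\<close>
    also have "\<dots> \<le> (\<integral>x. 8 / 3 * \<rho>\<^sup>2 / t\<^sup>2 * (x^6 + 3 * x^2) \<partial>std_normal)"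
    proof (rule integral_mono)
      fix x
      have "\<bar>f x * (h x - h 0)\<bar> \<le> ((x^4 + 3) / t\<^sup>2) * (8 / 3 * \<rho>\<^sup>2 * x\<^sup>2)"
        unfolding abs_mult using f_tail h_diff by (intro mult_mono) auto
      also have "\<dots> = 8 / 3 * \<rho>\<^sup>2 / t\<^sup>2 * (x^6 + 3 * x^2)"
        by (simp add: field_simps power_add[symmetric])
      finally show "\<bar>f x * (h x - h 0)\<bar> \<le> 8 / 3 * \<rho>\<^sup>2 / t\<^sup>2 * (x^6 + 3 * x^2)" .
    qed (use int_fh int_f0 in \<open>auto simp: right_diff_distrib std_normal_moments\<close>)
    also have "\<dots> = 48 * \<rho>\<^sup>2 / t\<^sup>2"
      by (simp add: std_normal_moments)
    also have "\<dots> \<le> 54 * \<rho>\<^sup>2 / t\<^sup>2"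
      by (intro divide_right_mono) auto
    finally show ?thesis .
  qed
qed

section \<open>Quantiles\<close>

lemma chi2_1_cdf_mono: "x \<le> y \<Longrightarrow> chi2_1_cdf x \<le> chi2_1_cdf y"
proof -
  interpret prob_space std_normal by (rule prob_space_std_normal)
  show "x \<le> y \<Longrightarrow> chi2_1_cdf x \<le> chi2_1_cdf y"
    unfolding chi2_1_cdf_def by (intro finite_measure_mono) auto
qed

lemma chi2_1_cdf_eq: "0 \<le> x \<Longrightarrow> chi2_1_cdf x = measure std_normal {..sqrt x} - measure std_normal {..- sqrt x}"
  by (simp add: chi2_1_cdf_Icc measure_std_normal_Icc_cdf order_trans[of _ 0])

lemma continuous_on_std_normal_cdf: "continuous_on A (\<lambda>x. measure std_normal {..x})"
  using std_normal_cdf_deriv by (meson DERIV_isCont continuous_at_imp_continuous_on)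

lemma continuous_on_chi2_1_cdf: "continuous_on {0..} chi2_1_cdf"
proof -
  have "continuous_on {0..} (\<lambda>x. measure std_normal {..sqrt x} - measure std_normal {..- sqrt x})"
    by (intro continuous_intros continuous_on_compose2[OF continuous_on_std_normal_cdf[of UNIV]]) auto
  then show ?thesis
    by (rule continuous_on_eq) (simp add: chi2_1_cdf_eq)
qed

text \<open>The window has length \<open>2 * sqrt x\<close> and the density is at most 1/2. This
  keeps quantiles of levels from 1/2 on above 1/4, and the c.d.f. small far below the noise
  scale.\<close>

lemma chi2_1_cdf_le_sqrt: "0 \<le> x \<Longrightarrow> chi2_1_cdf x \<le> sqrt x"
proof -
  assume x: "0 \<le> x"
  have "norm (measure std_normal {..sqrt x} - measure std_normal {..- sqrt x}) \<le> 1 / 2 * norm (sqrt x - - sqrt x)"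
    by (rule field_differentiable_bound[where S=UNIV and f'=std_normal_density])
      (use std_normal_cdf_deriv std_normal_density_le_half in auto)
  then show ?thesis using x by (simp add: chi2_1_cdf_eq)
qed

text \<open>On the right half of the window the density up to 4 is at least its value at 4, and
  \<open>y - x\<close> is at most 8 times the increment of the square root. Read backwards, this is
  the Lipschitz bound for the quantile; going up to 16 leaves a reserve above the level 8, the
  largest one compared.\<close>

lemma chi2_1_cdf_increment:
  assumes "0 \<le> x" "x \<le> y" "y \<le> 16"
  shows "std_normal_density 4 / 8 * (y - x) \<le> chi2_1_cdf y - chi2_1_cdf x"
proof -
  interpret prob_space std_normal by (rule prob_space_std_normal)
  define p where "p = std_normal_density 4"
  have p: "0 < p" by (simp add: p_def normal_density_pos)
  have xy: "0 \<le> sqrt x" "sqrt x \<le> sqrt y" using assms by auto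
  have sy: "sqrt y \<le> 4" using real_sqrt_le_mono[OF assms(3)] by simp
  have "p * (sqrt y - sqrt x) = integral {sqrt x..sqrt y} (\<lambda>_. p)"
    using xy by (simp add: content_real mult.commute)
  also have "\<dots> \<le> integral {sqrt x..sqrt y} std_normal_density"
  proof (rule integral_le)
    show "std_normal_density integrable_on {sqrt x..sqrt y}"
      by (intro integrable_continuous_real continuous_on_std_normal_density)
    fix z assume z: "z \<in> {sqrt x..sqrt y}"
    then have "0 \<le> z" "z \<le> 4" using xy(1) sy by (auto simp del: real_sqrt_ge_0_iff)
    then have "z\<^sup>2 \<le> 4\<^sup>2" by (intro power_mono) auto
    then show "p \<le> std_normal_density z"
      by (auto simp: std_normal_density_def p_def intro!: divide_right_mono)
  qed auto
  also have "\<dots> = measure std_normal {..sqrt y} - measure std_normal {..sqrt x}"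
    using xy by (simp add: measure_std_normal_Icc[symmetric] measure_std_normal_Icc_cdf)
  also have "\<dots> \<le> chi2_1_cdf y - chi2_1_cdf x"
    using assms xy finite_measure_mono[of "{..- sqrt y}" "{..- sqrt x}"] by (simp add: chi2_1_cdf_eq)
  finally have 1: "p * (sqrt y - sqrt x) \<le> chi2_1_cdf y - chi2_1_cdf x" .
  have "y - x = (sqrt y - sqrt x) * (sqrt y + sqrt x)"
    using assms by (simp add: algebra_simps)
  also have "\<dots> \<le> (sqrt y - sqrt x) * 8"
    using xy(2) order_trans[OF xy(2) sy] sy by (intro mult_left_mono) linarith+
  finally have "p / 8 * (y - x) \<le> p / 8 * ((sqrt y - sqrt x) * 8)"
    using p by (intro mult_left_mono) auto
  also have "\<dots> = p * (sqrt y - sqrt x)" by simp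
  finally show ?thesis using 1 by (simp only: p_def)
qed

lemma chi2_1_cdf_less_1: "chi2_1_cdf x < 1"
proof (cases "x \<le> 0")
  case True
  then have "chi2_1_cdf x \<le> chi2_1_cdf 0" by (rule chi2_1_cdf_mono)
  also have "\<dots> \<le> 0" using chi2_1_cdf_le_sqrt[of 0] by simp
  finally show ?thesis by simp
next
  case False
  interpret prob_space std_normal by (rule prob_space_std_normal)
  define a where "a = sqrt x"
  have a: "a > 0" using False by (simp add: a_def)
  have "0 < integral {a..a + 1} (\<lambda>_. std_normal_density (a + 1))"
    by (simp add: content_real normal_density_pos)
  also have "\<dots> \<le> integral {a..a + 1} std_normal_density"
  proof (rule integral_le)
    show "std_normal_density integrable_on {a..a + 1}"
      by (intro integrable_continuous_real continuous_on_std_normal_density)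
    fix z assume z: "z \<in> {a..a + 1}"
    then have "z\<^sup>2 \<le> (a + 1)\<^sup>2" using a by (intro power_mono) auto
    then show "std_normal_density (a + 1) \<le> std_normal_density z"
      by (auto simp: std_normal_density_def intro!: divide_right_mono)
  qed auto
  also have "\<dots> = measure std_normal {..a + 1} - measure std_normal {..a}"
    by (simp add: measure_std_normal_Icc[symmetric] measure_std_normal_Icc_cdf)
  also have "\<dots> \<le> 1 - (measure std_normal {..a} - measure std_normal {..- a})"
    using prob_le_1[of "{..a + 1}"] measure_nonneg[of std_normal "{..-a}"] by linarith
  also have "\<dots> = 1 - chi2_1_cdf x"
    using False by (simp add: chi2_1_cdf_eq a_def)
  finally show ?thesis by simp
qed

text \<open>The infimum runs over the empty set. This happens when all observations lie below the
  chosen level; the estimate is then \<open>t / \<infinity> = 0\<close>.\<close>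

lemma chi2_1_quantile_1: "chi2_1_quantile 1 = \<infinity>"
proof -
  have "{ereal x | x. chi2_1_cdf x \<ge> 1} = {}" using chi2_1_cdf_less_1 by (auto simp: not_le)
  then show ?thesis unfolding chi2_1_quantile_def by (simp only:) (simp add: top_ereal_def)
qed

text \<open>The tail bound makes the set under the infimum nonempty,
  \<open>chi2_1_cdf_le_sqrt\<close> bounds it below, and continuity makes it closed, so the infimum
  is attained; comparison with a root from the intermediate value theorem excludes a jump.\<close>

lemma chi2_1_quantile_finite:
  assumes p: "1 / 2 \<le> p" "p < 1"
  obtains q where "chi2_1_quantile p = ereal q" "1 / 4 \<le> q" "chi2_1_cdf q = p"
proof -
  define A where "A = {x. p \<le> chi2_1_cdf x}"
  have lower: "1 / 4 \<le> x" if "p \<le> chi2_1_cdf x" for x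
  proof -
    have "0 \<le> x"
    proof (rule ccontr)
      assume "\<not> 0 \<le> x"
      then have "chi2_1_cdf x \<le> chi2_1_cdf 0" by (intro chi2_1_cdf_mono) auto
      then show False using chi2_1_cdf_le_sqrt[of 0] that p by simp
    qed
    then have "1 / 2 \<le> sqrt x" using chi2_1_cdf_le_sqrt[of x] that p by simp
    then have "(1 / 2)\<^sup>2 \<le> (sqrt x)\<^sup>2" by (intro power_mono) auto
    then show ?thesis using \<open>0 \<le> x\<close> by (simp add: power2_eq_square)
  qed
  \<comment> \<open>Chosen so that \<open>3 / y^2 <= 3 / y <= 1 - p\<close>.\<close>
  define y where "y = 3 / (1 - p) + 1"
  have y: "1 \<le> y" using p by (simp add: y_def)
  have "3 / y\<^sup>2 \<le> 3 / y" using y by (intro divide_left_mono) (auto simp: power2_eq_square)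
  also have "3 / y \<le> 1 - p"
  proof -
    have "1 - p \<noteq> 0" using p by simp
    then have "(1 - p) * (3 / (1 - p)) = 3"
      unfolding times_divide_eq_right by (rule nonzero_mult_div_cancel_left)
    then have "(1 - p) * y = 3 + (1 - p)" by (simp only: y_def distrib_left mult_1_right)
    then show ?thesis using p y by (simp add: divide_le_eq)
  qed
  finally have py: "p \<le> chi2_1_cdf y" using chi2_1_cdf_tail[of y] y by linarith
  have c0: "chi2_1_cdf 0 = 0" using chi2_1_cdf_le_sqrt[of 0] chi2_1_cdf_nonneg[of 0] by simp
  obtain r where r: "0 \<le> r" "chi2_1_cdf r = p"
    using IVT'[of chi2_1_cdf 0 p y] c0 p py y continuous_on_subset[OF continuous_on_chi2_1_cdf, of "{0..y}"]
    by auto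
  define q where "q = Inf A"
  have A: "A \<noteq> {}" "bdd_below A"
    using py lower by (auto simp: A_def intro!: bdd_belowI[of _ "1 / 4"])
  have q: "1 / 4 \<le> q" unfolding q_def using A lower by (intro cInf_greatest) (auto simp: A_def)
  have qr: "q \<le> r" unfolding q_def using A r by (intro cInf_lower) (auto simp: A_def)
  have "chi2_1_cdf q = p"
  proof (rule antisym)
    show "chi2_1_cdf q \<le> p" using chi2_1_cdf_mono[OF qr] r by simp
    have "closed (A \<inter> {0..})"
      using continuous_on_closed_Collect_le[of "{0..}" "\<lambda>_. p" chi2_1_cdf] continuous_on_chi2_1_cdf
      by (auto simp: A_def Int_def conj_commute)
    moreover have "A \<inter> {0..} = A" using lower by (force simp: A_def)
    ultimately have "q \<in> A" unfolding q_def using A by (intro closed_contains_Inf) auto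
    then show "p \<le> chi2_1_cdf q" by (simp add: A_def)
  qed
  moreover have "chi2_1_quantile p = ereal q"
  proof -
    have "chi2_1_quantile p = Inf (ereal ` A)"
      unfolding chi2_1_quantile_def A_def by (intro arg_cong[where f=Inf]) auto
    also have "\<dots> = ereal q"
      unfolding q_def using ereal_Inf'[OF A(2) A(1)] by simp
    finally show ?thesis .
  qed
  ultimately show ?thesis using that q by blast
qed

section \<open>Pointwise error bound\<close>

text \<open>The passage from extended reals to reals: \<open>w\<close> is the estimate divided by
  the true variance, and an infinite quantile appears as \<open>w = 0\<close>. The crude bound
  \<open>4 * (t / v)\<close> serves levels outside the window.\<close>

lemma normalized_error_eq:
  assumes p: "1 / 2 \<le> p" "p \<le> 1" and t: "0 < t" and v: "0 < v"
  obtains w where "\<bar>ereal t / chi2_1_quantile p - ereal v\<bar> / ereal v = ereal \<bar>w - 1\<bar>"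
    "0 \<le> w" "w \<le> 4 * (t / v)"
    "p = 1 \<and> w = 0 \<or> (\<exists>q. 1 / 4 \<le> q \<and> chi2_1_cdf q = p \<and> w = t / v / q)"
proof (cases "p = 1")
  case True
  then show ?thesis using t v by (intro that[of 0]) (auto simp: chi2_1_quantile_1)
next
  case False
  then obtain q where q: "chi2_1_quantile p = ereal q" "1 / 4 \<le> q" "chi2_1_cdf q = p"
    using p chi2_1_quantile_finite[of p] by auto
  have "\<bar>t / q - v\<bar> / v = \<bar>(t / q - v) / v\<bar>" using v by simp
  also have "(t / q - v) / v = t / v / q - 1" using v by (simp add: diff_divide_distrib mult.commute)
  finally have "\<bar>ereal t / chi2_1_quantile p - ereal v\<bar> / ereal v = ereal \<bar>t / v / q - 1\<bar>"
    using q v by simp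
  moreover have "t / v / q \<le> t / v / (1 / 4)"
    using q t v by (intro divide_left_mono) auto
  ultimately show ?thesis using q t v by (intro that[of "t / v / q"]) (auto simp: mult.commute)
qed

text \<open>If \<open>q <= 16\<close>, then \<open>w - 1 = (u - q) / q\<close> with
  \<open>q >= 1 / 4\<close> costs a factor 4, and inverting \<open>chi2_1_cdf_increment\<close> the
  rest. A larger or infinite quantile gives an error of at most 1, but forces \<open>p\<close> above
  the c.d.f. at \<open>u\<close> by the reserve between 8 and 16.\<close>

lemma quantile_ratio_lipschitz:
  assumes u: "0 \<le> u" "u \<le> 8" and w: "p = 1 \<and> w = 0 \<or> (\<exists>q. 1 / 4 \<le> q \<and> chi2_1_cdf q = p \<and> w = u / q)"
  shows "\<bar>w - 1\<bar> \<le> 32 / std_normal_density 4 * \<bar>p - chi2_1_cdf u\<bar>"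
proof -
  define \<kappa> where "\<kappa> = std_normal_density 4 / 8"
  have \<kappa>: "0 < \<kappa>" by (simp add: \<kappa>_def normal_density_pos)
  have inc: "\<kappa> * (y - x) \<le> chi2_1_cdf y - chi2_1_cdf x" if "0 \<le> x" "x \<le> y" "y \<le> 16" for x y
    using chi2_1_cdf_increment[OF that] by (simp add: \<kappa>_def)
  have gap: "\<kappa> * 8 \<le> chi2_1_cdf 16 - chi2_1_cdf u"
    using inc[of 8 16] chi2_1_cdf_mono[of u 8] u by simp
  have "\<kappa> * \<bar>w - 1\<bar> \<le> 4 * \<bar>p - chi2_1_cdf u\<bar>"
    using w
  proof
    assume "p = 1 \<and> w = 0"
    then show ?thesis using gap chi2_1_cdf_le_1[of 16] \<kappa> by simp
  next
    assume "\<exists>q. 1 / 4 \<le> q \<and> chi2_1_cdf q = p \<and> w = u / q"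
    then obtain q where q: "1 / 4 \<le> q" "chi2_1_cdf q = p" "w = u / q" by blast
    show ?thesis
    proof (cases "q \<le> 16")
      case True
      have "\<bar>w - 1\<bar> = \<bar>(u - q) / q\<bar>" using q by (simp add: diff_divide_distrib)
      also have "\<dots> = \<bar>u - q\<bar> / q" using q by simp
      also have "\<dots> \<le> \<bar>u - q\<bar> / (1 / 4)" using q by (intro divide_left_mono) auto
      finally have "\<kappa> * \<bar>w - 1\<bar> \<le> \<kappa> * (4 * \<bar>u - q\<bar>)" using \<kappa> by (intro mult_left_mono) auto
      also have "\<kappa> * (4 * \<bar>u - q\<bar>) \<le> 4 * \<bar>p - chi2_1_cdf u\<bar>"
        using inc[of u q] inc[of q u] q True u by (cases "u \<le> q") (auto simp: abs_if algebra_simps)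
      finally show ?thesis .
    next
      case False
      have "\<bar>w - 1\<bar> \<le> 1" using q False u by (auto simp: abs_le_iff divide_le_eq)
      then have "\<kappa> * \<bar>w - 1\<bar> \<le> \<kappa> * 1" using \<kappa> by (intro mult_left_mono) auto
      then have "\<kappa> * \<bar>w - 1\<bar> \<le> \<kappa> * 8" using \<kappa> by linarith
      also have "\<kappa> * 8 \<le> 4 * \<bar>p - chi2_1_cdf u\<bar>"
      proof -
        have "chi2_1_cdf 16 \<le> p" using chi2_1_cdf_mono[of 16 q] False q(2) by simp
        then have x: "\<kappa> * 8 \<le> p - chi2_1_cdf u" using gap by simp
        have "\<dots> \<le> \<bar>p - chi2_1_cdf u\<bar>" by (rule abs_ge_self)
        also have "\<dots> \<le> 4 * \<bar>p - chi2_1_cdf u\<bar>" by simp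
        finally show ?thesis by (rule order_trans[OF x])
      qed
      finally show ?thesis .
    qed
  qed
  then show ?thesis using \<kappa> by (simp add: \<kappa>_def field_simps)
qed

section \<open>The stopping level\<close>

lemma emp_cdf_sq_mono: "t \<le> t' \<Longrightarrow> emp_cdf_sq d S Y t \<le> emp_cdf_sq d S Y t'"
  unfolding emp_cdf_sq_def by (intro divide_right_mono of_nat_mono card_mono) auto

lemma emp_cdf_sq_le_1: "emp_cdf_sq d S Y t \<le> 1"
proof -
  have "card {i. i < d \<and> (Y i / sqrt (S i i))\<^sup>2 \<le> t} \<le> card {..<d}" by (intro card_mono) auto
  then show ?thesis by (cases "d = 0") (auto simp: emp_cdf_sq_def divide_le_eq)
qed

text \<open>The infimum in \<open>int\<close> is meaningful because the largest squared observation
  yields an admissible level, and the smallest one, positive as no observation vanishes, bounds all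
  of them below.\<close>

lemma t_hat_minimal:
  assumes d: "1 \<le> d" and nz: "\<And>i. i < d \<Longrightarrow> Y i \<noteq> 0" "\<And>i. i < d \<Longrightarrow> 0 < S i i"
  obtains l :: int where "t_hat d S Y = 2 powr real_of_int l" "1 / 2 \<le> emp_cdf_sq d S Y (2 powr real_of_int l)"
    "\<And>l'. l' < l \<Longrightarrow> emp_cdf_sq d S Y (2 powr real_of_int l') < 1 / 2"
proof -
  define L where "L = {l::int. emp_cdf_sq d S Y (2 powr real_of_int l) \<ge> 1/2}"
  define a where "a i = (Y i / sqrt (S i i))\<^sup>2" for i
  have a_pos: "0 < a i" if "i < d" for i using nz[OF that] by (simp add: a_def)
  define b where "b = Min (a ` {..<d})"
  have b: "0 < b" "\<And>i. i < d \<Longrightarrow> b \<le> a i"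
    using d a_pos by (auto simp: b_def Min_gr_iff lessThan_empty_iff)
  define B where "B = Max (a ` {..<d})"
  have B: "\<And>i. i < d \<Longrightarrow> a i \<le> B" by (auto simp: B_def)
  have Bpos: "0 < B" using a_pos[of 0] B[of 0] d by auto
  define m where "m = \<lfloor>log 2 b\<rfloor>"
  have low: "m \<le> l" if "l \<in> L" for l
  proof -
    have "{i. i < d \<and> a i \<le> 2 powr real_of_int l} \<noteq> {}"
    proof
      assume "{i. i < d \<and> a i \<le> 2 powr real_of_int l} = {}"
      then have "emp_cdf_sq d S Y (2 powr real_of_int l) = 0"
        unfolding emp_cdf_sq_def a_def[symmetric] by simp
      then show False using that by (simp add: L_def)
    qed
    then have "b \<le> 2 powr real_of_int l" using b(2) by (auto intro: order_trans)
    then have "log 2 b \<le> real_of_int l" using b by (simp add: log_le_iff)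
    then show ?thesis unfolding m_def by linarith
  qed
  define M where "M = \<lceil>log 2 B\<rceil>"
  have M: "M \<in> L"
  proof -
    have "B \<le> 2 powr real_of_int M" using Bpos by (simp add: M_def log_le_iff[symmetric])
    then have "{i. i < d \<and> a i \<le> 2 powr real_of_int M} = {..<d}" using B by (auto intro: order_trans)
    then have "emp_cdf_sq d S Y (2 powr real_of_int M) = 1"
      unfolding emp_cdf_sq_def a_def[symmetric] using d by simp
    then show ?thesis by (simp add: L_def)
  qed
  \<comment> \<open>Shifting by the lower bound \<open>m\<close> turns the minimum over integers
    into a well-founded search over \<open>nat\<close>.\<close>
  define n where "n = (LEAST n::nat. m + int n \<in> L)"
  have "m + int (nat (M - m)) \<in> L" using M low[OF M] by simp
  then have nL: "m + int n \<in> L" unfolding n_def by (rule LeastI)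
  have least: "m + int n \<le> l" if "l \<in> L" for l
  proof -
    have "m + int (nat (l - m)) \<in> L" using that low[OF that] by simp
    then have "n \<le> nat (l - m)" unfolding n_def by (rule Least_le)
    then show ?thesis using low[OF that] by linarith
  qed
  have "Inf L = m + int n" using nL least by (intro cInf_eq_minimum) auto
  then have "t_hat d S Y = 2 powr real_of_int (m + int n)" by (simp add: t_hat_def L_def)
  moreover have "1 / 2 \<le> emp_cdf_sq d S Y (2 powr real_of_int (m + int n))" using nL by (simp add: L_def)
  moreover have "emp_cdf_sq d S Y (2 powr real_of_int l') < 1 / 2" if "l' < m + int n" for l'
    using least[of l'] that by (force simp: L_def)
  ultimately show ?thesis by (rule that)
qed

text \<open>At 4 times the variance the chi-square c.d.f. is at least \<open>1 - 3 / 16\<close>,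
  safely above 1/2; rounding up to a power of 2 loses at most a further factor 2.\<close>

lemma dyadic_scale_exists:
  assumes "0 < v"
  obtains l :: int where "4 * v \<le> 2 powr real_of_int l" "2 powr real_of_int l \<le> 8 * v"
proof
  define l where "l = \<lceil>log 2 (4 * v)\<rceil>"
  show "4 * v \<le> 2 powr real_of_int l"
    using assms by (simp add: l_def log_le_iff[symmetric])
  have "real_of_int l \<le> log 2 (4 * v) + 1" by (simp add: l_def)
  then have "2 powr real_of_int l \<le> 2 powr (log 2 (4 * v) + 1)" by simp
  also have "\<dots> = 8 * v" using assms by (simp add: powr_add)
  finally show "2 powr real_of_int l \<le> 8 * v" .
qed

text \<open>The stopping level either lies in a window of bounded width around the scale of the noise,
  or it witnesses a deviation of constant order of the empirical c.d.f. at a fixed dyadic level.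
  Far above the noise scale the error grows like the level, and the factor 2^k has to be paid for
  by the decay of the second moment of the deviation.\<close>

lemma sigma_S_sq_error_pointwise:
  fixes Fd :: "real \<Rightarrow> real"
  assumes d: "1 \<le> d" and nz: "\<And>i. i < d \<Longrightarrow> Y i \<noteq> 0" "\<And>i. i < d \<Longrightarrow> 0 < S i i"
    and v: "0 < v"
    and close: "\<And>u. \<bar>emp_cdf_sq d S Y (v * u) - Fd u\<bar> \<le> \<epsilon>" and \<epsilon>: "\<epsilon> \<le> 1 / 8"
    and l0: "4 * v \<le> 2 powr real_of_int l0" "2 powr real_of_int l0 \<le> 8 * v"
    and u0: "u0 = 2 powr real_of_int l0 / v"
  defines "D \<equiv> \<lambda>u. \<bar>Fd u - chi2_1_cdf u\<bar>"
  shows "\<exists>z. \<bar>sigma_S_sq d S Y - ereal v\<bar> / ereal v = ereal z \<and>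
    ((\<exists>j<8. z \<le> 32 / std_normal_density 4 * (\<epsilon> + D (u0 / 2 ^ j))) \<or> (\<exists>k. z \<le> 4096 * 2 ^ k * (D (u0 * 2 ^ k))\<^sup>2))"
proof -
  define K where "K = 32 / std_normal_density 4"
  have K: "64 \<le> K"
    using std_normal_density_le_half[of 4] normal_density_pos[of 1 0 4] by (simp add: K_def field_simps)
  have u0_bd: "4 \<le> u0" "u0 \<le> 8" using l0 v by (auto simp: u0 field_simps)
  have \<epsilon>0: "0 \<le> \<epsilon>" using order_trans[OF abs_ge_zero close] .
  define F where "F = emp_cdf_sq d S Y"
  have dev: "\<bar>F (v * u) - chi2_1_cdf u\<bar> \<le> \<epsilon> + D u" for u
    using close[of u] unfolding D_def F_def by linarith
  obtain l where l: "t_hat d S Y = 2 powr real_of_int l" "1 / 2 \<le> F (2 powr real_of_int l)"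
    "\<And>l'. l' < l \<Longrightarrow> F (2 powr real_of_int l') < 1 / 2"
    using t_hat_minimal[of d Y S, OF d nz] unfolding F_def by blast
  define p where "p = F (2 powr real_of_int l)"
  define u where "u = 2 powr real_of_int l / v"
  have p: "1 / 2 \<le> p" "p \<le> 1" using l(2) emp_cdf_sq_le_1 by (auto simp: p_def F_def)
  obtain w where w: "\<bar>ereal (2 powr real_of_int l) / chi2_1_quantile p - ereal v\<bar> / ereal v = ereal \<bar>w - 1\<bar>"
    "0 \<le> w" "w \<le> 4 * u"
    "p = 1 \<and> w = 0 \<or> (\<exists>q. 1 / 4 \<le> q \<and> chi2_1_cdf q = p \<and> w = u / q)"
    using normalized_error_eq[OF p _ v, of "2 powr real_of_int l"] unfolding u_def by auto
  have err: "\<bar>sigma_S_sq d S Y - ereal v\<bar> / ereal v = ereal \<bar>w - 1\<bar>"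
    using w(1) p by (simp add: sigma_S_sq_def sigma_S_sq_at_def l(1) p_def F_def)
  have u_pos: "0 < u" using v by (simp add: u_def)
  have vu0: "v * u0 = 2 powr real_of_int l0" using v by (simp add: u0)
  have down: "v * (u0 / 2 ^ j) = 2 powr real_of_int (l0 - int j)" for j
    using vu0 by (simp add: powr_diff powr_realpow)
  have up: "v * (u0 * 2 ^ j) = 2 powr real_of_int (l0 + int j)" for j
    using vu0 by (simp add: powr_add powr_realpow flip: mult.assoc)
  \<comment> \<open>Seven steps down, \<open>u0 / 2 ^ 7 <= 1 / 16\<close> and the c.d.f. is at most
    1/4. So the indices 0 to 6 form the window, and 7 is the witness for everything below
    it.\<close>
  consider "l \<le> l0 - 7" | "l0 - 6 \<le> l" "l \<le> l0" | "l0 < l" by linarith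
  then have "(\<exists>j<8. \<bar>w - 1\<bar> \<le> K * (\<epsilon> + D (u0 / 2 ^ j))) \<or> (\<exists>k. \<bar>w - 1\<bar> \<le> 4096 * 2 ^ k * (D (u0 * 2 ^ k))\<^sup>2)"
  proof cases
    case 1
    have "2 powr real_of_int l \<le> v * (u0 / 2 ^ 7)" unfolding down using 1 by simp
    then have "1 / 2 \<le> F (v * (u0 / 2 ^ 7))" and u: "u \<le> u0 / 2 ^ 7"
      using l(2) emp_cdf_sq_mono[of _ _ d S Y] v by (auto simp: F_def u_def field_simps intro: order_trans)
    moreover have "chi2_1_cdf (u0 / 2 ^ 7) \<le> 1 / 4"
    proof -
      have "chi2_1_cdf (u0 / 2 ^ 7) \<le> sqrt (u0 / 2 ^ 7)" using u0_bd by (intro chi2_1_cdf_le_sqrt) auto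
      also have "\<dots> \<le> 1 / 4" using u0_bd by (intro real_le_lsqrt) (auto simp: power2_eq_square)
      finally show ?thesis .
    qed
    ultimately have big: "1 / 4 \<le> \<epsilon> + D (u0 / 2 ^ 7)" using dev[of "u0 / 2 ^ 7"] by linarith
    have "w \<le> 1" using w(3) u u0_bd by simp
    then have "\<bar>w - 1\<bar> \<le> 64 * (1 / 4)" using w(2) by simp
    also have "\<dots> \<le> K * (\<epsilon> + D (u0 / 2 ^ 7))" using big K by (intro mult_mono) auto
    finally show ?thesis by (intro disjI1 exI[of _ 7]) auto
  next
    case 2
    define j where "j = nat (l0 - l)"
    have lj: "l = l0 - int j" "j < 8" using 2 by (auto simp: j_def)
    have uj: "u = u0 / 2 ^ j" using down[of j] v by (simp add: u_def lj field_simps)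
    have "u \<le> u0" using u0_bd by (simp add: uj divide_le_eq)
    then have "\<bar>w - 1\<bar> \<le> K * \<bar>p - chi2_1_cdf u\<bar>"
      unfolding K_def using u_pos u0_bd w(4) by (intro quantile_ratio_lipschitz) auto
    also have "\<bar>p - chi2_1_cdf u\<bar> \<le> \<epsilon> + D u"
      using dev[of u] v by (simp add: p_def u_def)
    finally show ?thesis using lj K unfolding uj[symmetric]
      by (intro disjI1 exI[of _ j]) (auto simp: uj intro: mult_left_mono)
  next
    case 3
    define k where "k = nat (l - l0 - 1)"
    have lk: "l = l0 + int (Suc k)" using 3 by (simp add: k_def)
    have uk: "u = u0 * 2 ^ Suc k" using up[of "Suc k"] v by (simp add: u_def lk field_simps)
    \<comment> \<open>The level just below the chosen one, counted by \<open>k\<close>, is still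
      under 1/2 by minimality, although the c.d.f. is at least 3/4 there; with
      \<open>\<epsilon> <= 1 / 8\<close> a deviation of 1/8 remains.\<close>
    have "F (v * (u0 * 2 ^ k)) < 1 / 2" unfolding up by (rule l(3)) (simp add: lk)
    moreover have "3 / 4 \<le> chi2_1_cdf (u0 * 2 ^ k)"
    proof -
      have "4 * 1 \<le> u0 * 2 ^ k" using u0_bd by (intro mult_mono) auto
      then have "chi2_1_cdf 4 \<le> chi2_1_cdf (u0 * 2 ^ k)" by (intro chi2_1_cdf_mono) auto
      then show ?thesis using chi2_1_cdf_tail[of 4] by simp
    qed
    ultimately have "1 / 8 \<le> D (u0 * 2 ^ k)" using dev[of "u0 * 2 ^ k"] \<epsilon> by linarith
    then have "(1 / 8)\<^sup>2 \<le> (D (u0 * 2 ^ k))\<^sup>2" by (intro power_mono) auto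
    then have D2: "1 \<le> 64 * (D (u0 * 2 ^ k))\<^sup>2" by (simp add: power2_eq_square)
    have "w \<le> 4 * (8 * 2 ^ Suc k)" using w(3) u0_bd unfolding uk
      by (elim order_trans) (intro mult_left_mono mult_right_mono, auto)
    moreover have "(1::real) \<le> 2 ^ k" by simp
    \<comment> \<open>Here \<open>64 = 4 * 8 * 2\<close>; inserting \<open>1 <= 64 * D^2\<close>
      then yields the constant 4096.\<close>
    ultimately have "\<bar>w - 1\<bar> \<le> 64 * 2 ^ k * 1" using w(2) unfolding power_Suc by linarith
    also have "\<dots> \<le> 64 * 2 ^ k * (64 * (D (u0 * 2 ^ k))\<^sup>2)" using D2 by (intro mult_left_mono) auto
    finally show ?thesis by (intro disjI2 exI[of _ k]) simp
  qed
  then show ?thesis using err unfolding K_def by blast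
qed

section \<open>Second moment of the empirical c.d.f.\<close>

definition emp_dev :: "nat \<Rightarrow> (nat \<Rightarrow> nat \<Rightarrow> real) \<Rightarrow> real \<Rightarrow> (nat \<Rightarrow> real) \<Rightarrow> real" where
  "emp_dev d S u e = emp_cdf_sq d S e u - chi2_1_cdf u"

lemma emp_dev_eq:
  assumes "1 \<le> d"
  shows "emp_dev d S u e = (\<Sum>i<d. indicator {z. z\<^sup>2 \<le> u} (e i / sqrt (S i i)) - chi2_1_cdf u) / real d"
proof -
  have "(\<Sum>i<d. indicator {z. z\<^sup>2 \<le> u} (e i / sqrt (S i i))) = real (card {i. i < d \<and> (e i / sqrt (S i i))\<^sup>2 \<le> u})"
    by (simp add: indicator_def sum.If_cases Int_def flip: of_bool_def)
  then show ?thesis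
    using assms by (simp add: emp_dev_def emp_cdf_sq_def sum_subtractf diff_divide_distrib)
qed

text \<open>Off the support of \<open>\<theta>\<close>, scaling the level by
  \<open>\<sigma>^2\<close> undoes the noise scale exactly, so at most \<open>s\<close> coordinates
  change sides. The bound holds for every outcome and every level, hence also at the random stopping
  level.\<close>

lemma emp_cdf_sq_sparse_shift:
  assumes \<sigma>: "0 < \<sigma>" and sp: "l0_norm d \<theta> \<le> s"
  shows "\<bar>emp_cdf_sq d S (\<lambda>i. \<theta> i + \<sigma> * e i) (\<sigma>\<^sup>2 * u) - emp_cdf_sq d S e u\<bar> \<le> real s / real d"
proof -
  define T where "T = {i. i < d \<and> \<theta> i \<noteq> 0}"
  define A where "A = {i. i < d \<and> ((\<theta> i + \<sigma> * e i) / sqrt (S i i))\<^sup>2 \<le> \<sigma>\<^sup>2 * u}"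
  define B where "B = {i. i < d \<and> (e i / sqrt (S i i))\<^sup>2 \<le> u}"
  have same: "i \<in> A \<longleftrightarrow> i \<in> B" if "i \<notin> T" for i
  proof (cases "i < d")
    case True
    then have "((\<theta> i + \<sigma> * e i) / sqrt (S i i))\<^sup>2 = \<sigma>\<^sup>2 * (e i / sqrt (S i i))\<^sup>2"
      using that by (simp add: T_def power_mult_distrib power_divide)
    then show ?thesis using True \<sigma> by (simp add: A_def B_def)
  qed (simp add: A_def B_def)
  have fin: "finite A" "finite B" "finite T" by (auto simp: A_def B_def T_def)
  have "card A \<le> card (B \<union> T)" "card B \<le> card (A \<union> T)" using same fin by (auto intro!: card_mono)
  then have "card A \<le> card B + card T" "card B \<le> card A + card T"
    using card_Un_le[of B T] card_Un_le[of A T] by linarith+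
  moreover have "card T \<le> s" using sp by (simp add: l0_norm_def T_def)
  ultimately have "\<bar>real (card A) - real (card B)\<bar> \<le> real s" by linarith
  then have "\<bar>real (card A) - real (card B)\<bar> / real d \<le> real s / real d" by (intro divide_right_mono) auto
  then show ?thesis
    by (simp add: emp_cdf_sq_def A_def B_def diff_divide_distrib[symmetric])
qed

section \<open>Moments and expected error in the Gaussian model\<close>

locale gaussian_model =
  fixes d :: nat and S :: "nat \<Rightarrow> nat \<Rightarrow> real"
  assumes d: "1 \<le> d" and cov: "is_cov_matrix d S" and diag: "\<And>i. i < d \<Longrightarrow> 0 < S i i"
begin

sublocale G: prob_space "gaussian_vec d S"
  by (rule prob_space_gaussian_vec)

definition corr :: "nat \<Rightarrow> nat \<Rightarrow> real" where
  "corr i j = S i j / (sqrt (S i i) * sqrt (S j j))"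

lemma frob_norm_corr: "frob_norm_tilde d S = sqrt (\<Sum>i<d. \<Sum>j<d. (corr i j)\<^sup>2)"
  by (simp add: frob_norm_tilde_def corr_def)

lemma frob_norm_sq: "(frob_norm_tilde d S)\<^sup>2 = (\<Sum>i<d. \<Sum>j<d. (corr i j)\<^sup>2)"
  unfolding frob_norm_corr by (simp add: sum_nonneg)

text \<open>The diagonal correlations are 1. Positivity matters because the norm later occurs as a
  divisor.\<close>

lemma frob_norm_pos: "0 < frob_norm_tilde d S"
proof -
  have "(corr 0 0)\<^sup>2 \<le> (\<Sum>j<d. (corr 0 j)\<^sup>2)" using d by (intro member_le_sum) auto
  also have "\<dots> \<le> (\<Sum>i<d. \<Sum>j<d. (corr i j)\<^sup>2)"
    using d by (intro member_le_sum[where f="\<lambda>i. \<Sum>j<d. (corr i j)\<^sup>2"]) (auto intro: sum_nonneg)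
  finally have "1 \<le> (\<Sum>i<d. \<Sum>j<d. (corr i j)\<^sup>2)"
    using d diag[of 0] by (simp add: corr_def)
  then show ?thesis unfolding frob_norm_corr by simp
qed

text \<open>Every correlation is at most 1 in absolute value by Cauchy-Schwarz; this is what later
  lowers r^2 to r.\<close>

lemma frob_norm_le: "frob_norm_tilde d S \<le> real d"
proof -
  have "(corr i j)\<^sup>2 \<le> 1" if "i < d" "j < d" for i j
    using cov_matrix_Cauchy_Schwarz[OF cov that] diag[OF that(1)] diag[OF that(2)]
    by (simp add: corr_def power_divide power_mult_distrib divide_le_eq_1)
  then have "(\<Sum>i<d. \<Sum>j<d. (corr i j)\<^sup>2) \<le> (\<Sum>i<d. \<Sum>j<d. 1)"
    by (intro sum_mono) auto
  then show ?thesis unfolding frob_norm_corr by (intro real_le_lsqrt) (auto simp: power2_eq_square)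
qed

lemma measurable_coord: "i < d \<Longrightarrow> (\<lambda>e. e i / sqrt (S i i)) \<in> borel_measurable (gaussian_vec d S)"
  by measurable

lemma char_coord:
  assumes ij: "i < d" "j < d"
  shows "(\<integral>e. iexp (u * (e i / sqrt (S i i)) + v * (e j / sqrt (S j j))) \<partial>gaussian_vec d S) =
    of_real (exp (- (u\<^sup>2 + v\<^sup>2 + 2 * u * v * corr i j) / 2))"
proof -
  have "(\<integral>e. iexp (u * (e i / sqrt (S i i)) + v * (e j / sqrt (S j j))) \<partial>gaussian_vec d S) =
     (\<integral>e. iexp (u / sqrt (S i i) * e i + v / sqrt (S j j) * e j) \<partial>gaussian_vec d S)"
    by simp
  also have "\<dots> = of_real (exp (- ((u / sqrt (S i i))\<^sup>2 * S i i + (v / sqrt (S j j))\<^sup>2 * S j j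
      + 2 * (u / sqrt (S i i)) * (v / sqrt (S j j)) * S i j) / 2))"
    by (rule char_gaussian_vec_coordinates[OF cov ij])
  also have "(u / sqrt (S i i))\<^sup>2 * S i i + (v / sqrt (S j j))\<^sup>2 * S j j
      + 2 * (u / sqrt (S i i)) * (v / sqrt (S j j)) * S i j = u\<^sup>2 + v\<^sup>2 + 2 * u * v * corr i j"
    using diag[OF ij(1)] diag[OF ij(2)] by (simp add: corr_def power_divide)
  finally show ?thesis .
qed

text \<open>The law of a standardised coordinate has no atoms. With \<open>c\<close> the value at
  which an observation would vanish, this secures the hypothesis of \<open>t_hat_minimal\<close>
  almost surely.\<close>

lemma coord_neq_AE: "i < d \<Longrightarrow> AE e in gaussian_vec d S. e i / sqrt (S i i) \<noteq> c"
proof -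
  assume i: "i < d"
  have law: "distr (gaussian_vec d S) borel (\<lambda>e. e i / sqrt (S i i)) = std_normal"
    using char_coord[OF i i, of _ 0] by (intro G.distr_std_normalI measurable_coord i) simp
  have "AE z in std_normal. z \<noteq> c"
    by (rule AE_I[where N="{c}"]) (auto simp: emeasure_std_normal_singleton)
  then show ?thesis
    unfolding law[symmetric] by (subst (asm) AE_distr_iff) (use measurable_coord[OF i] in auto)
qed

lemma emp_dev_measurable [measurable]: "emp_dev d S u \<in> borel_measurable (gaussian_vec d S)"
proof -
  have [measurable]: "(\<lambda>e. indicator {z. z\<^sup>2 \<le> u} (e i / sqrt (S i i)) :: real) \<in> borel_measurable (gaussian_vec d S)"
    if "i < d" for i
    using measurable_compose[OF measurable_coord[OF that], of "indicator {z. z\<^sup>2 \<le> u} :: real \<Rightarrow> real" borel] by simp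
  show ?thesis
    unfolding emp_dev_eq[OF d, abs_def] by measurable
qed

text \<open>Expanding the square gives covariances of pairs, whose bounds by squared correlations
  add up to the squared Frobenius norm. The diagonal pairs obey the same bound with correlation
  1.\<close>

lemma emp_dev_second_moment:
  assumes u: "0 < u"
  shows "(\<integral>\<^sup>+e. ennreal ((emp_dev d S u e)\<^sup>2) \<partial>gaussian_vec d S) \<le> ennreal (54 * (frob_norm_tilde d S / real d)\<^sup>2 / u\<^sup>2)"
proof -
  define f where "f z = indicator {z. z\<^sup>2 \<le> u} z - chi2_1_cdf u" for z :: real
  have [measurable]: "f \<in> borel_measurable borel" unfolding f_def by measurable
  have f_bd: "\<bar>f z\<bar> \<le> 1" for z
    using chi2_1_cdf_nonneg[of u] chi2_1_cdf_le_1[of u] by (auto simp: f_def indicator_def)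
  define g where "g i e = f (e i / sqrt (S i i))" for i and e :: "nat \<Rightarrow> real"
  have [measurable]: "g i \<in> borel_measurable (gaussian_vec d S)" if "i < d" for i
    unfolding g_def by (rule measurable_compose[OF measurable_coord[OF that]]) simp
  have int: "integrable (gaussian_vec d S) (\<lambda>e. g i e * g j e)" if "i < d" "j < d" for i j
    using that f_bd by (intro G.integrable_const_bound[of _ 1] AE_I2) (auto simp: abs_mult g_def intro!: mult_le_one)
  have cov_bd: "(\<integral>e. g i e * g j e \<partial>gaussian_vec d S) \<le> 54 * (corr i j)\<^sup>2 / u\<^sup>2" if "i < d" "j < d" for i j
    using G.cov_sq_le_indicators[OF measurable_coord[OF that(1)] measurable_coord[OF that(2)] char_coord[OF that] u]
    unfolding g_def f_def by linarith
  have sq: "(emp_dev d S u e)\<^sup>2 = (\<Sum>i<d. \<Sum>j<d. g i e * g j e) / (real d)\<^sup>2" for e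
    unfolding emp_dev_eq[OF d] g_def f_def by (simp add: power_divide power2_eq_square[of "sum _ _"] sum_product)
  have "(\<integral>e. (\<Sum>i<d. \<Sum>j<d. g i e * g j e) \<partial>gaussian_vec d S) = (\<Sum>i<d. \<integral>e. (\<Sum>j<d. g i e * g j e) \<partial>gaussian_vec d S)"
    by (intro Bochner_Integration.integral_sum Bochner_Integration.integrable_sum int) auto
  also have "\<dots> = (\<Sum>i<d. \<Sum>j<d. \<integral>e. g i e * g j e \<partial>gaussian_vec d S)"
    by (intro sum.cong refl Bochner_Integration.integral_sum int) auto
  finally have E_sum: "(\<integral>e. (\<Sum>i<d. \<Sum>j<d. g i e * g j e) \<partial>gaussian_vec d S) = \<dots>" .
  have "integrable (gaussian_vec d S) (\<lambda>e. (emp_dev d S u e)\<^sup>2)"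
    unfolding sq using int by (intro integrable_divide Bochner_Integration.integrable_sum) auto
  then have "(\<integral>\<^sup>+e. ennreal ((emp_dev d S u e)\<^sup>2) \<partial>gaussian_vec d S) = ennreal (\<integral>e. (emp_dev d S u e)\<^sup>2 \<partial>gaussian_vec d S)"
    by (intro nn_integral_eq_integral) auto
  also have "(\<integral>e. (emp_dev d S u e)\<^sup>2 \<partial>gaussian_vec d S) =
      (\<Sum>i<d. \<Sum>j<d. \<integral>e. g i e * g j e \<partial>gaussian_vec d S) / (real d)\<^sup>2"
    by (simp add: sq E_sum)
  also have "\<dots> \<le> (\<Sum>i<d. \<Sum>j<d. 54 * (corr i j)\<^sup>2 / u\<^sup>2) / (real d)\<^sup>2"
    by (intro divide_right_mono sum_mono cov_bd) auto
  also have "\<dots> = 54 * (frob_norm_tilde d S / real d)\<^sup>2 / u\<^sup>2"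
    by (simp add: power_divide frob_norm_sq sum_distrib_left sum_divide_distrib mult.commute)
  finally show ?thesis by (auto intro: ennreal_leI)
qed

text \<open>Which level accounts for the error depends on the outcome, so a sum over all candidates
  is integrated: eight near levels and countably many far ones.\<close>

lemma expected_error_le:
  assumes \<sigma>: "0 < \<sigma>" and sp: "l0_norm d \<theta> \<le> s" and s: "real s \<le> real d / 8"
  defines "K \<equiv> 32 / std_normal_density 4"
  shows "(\<integral>\<^sup>+ e. e2ennreal (\<bar>sigma_S_sq d S (\<lambda>i. \<theta> i + \<sigma> * e i) - ereal (\<sigma>\<^sup>2)\<bar> / ereal (\<sigma>\<^sup>2)) \<partial>gaussian_vec d S)
    \<le> ennreal ((8 * K + 1) * 27649 * (real s / real d + frob_norm_tilde d S / real d))"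
proof -
  define \<epsilon> where "\<epsilon> = real s / real d"
  define r where "r = frob_norm_tilde d S / real d"
  have r: "0 < r" "r \<le> 1" using frob_norm_pos frob_norm_le d by (auto simp: r_def divide_le_eq_1)
  have \<epsilon>: "0 \<le> \<epsilon>" "\<epsilon> \<le> 1 / 8" using s d by (auto simp: \<epsilon>_def field_simps)
  have K: "0 < K" using normal_density_pos[of 1 0 4] by (simp add: K_def)
  have \<sigma>2: "0 < \<sigma>\<^sup>2" using \<sigma> by simp
  obtain l0 :: int where l0: "4 * \<sigma>\<^sup>2 \<le> 2 powr real_of_int l0" "2 powr real_of_int l0 \<le> 8 * \<sigma>\<^sup>2"
    using dyadic_scale_exists[OF \<sigma>2] .
  define u0 where "u0 = 2 powr real_of_int l0 / \<sigma>\<^sup>2"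
  have u0: "4 \<le> u0" using l0 \<sigma>2 by (simp add: u0_def pos_le_divide_eq)
  define Q where "Q u e = ennreal ((emp_dev d S u e)\<^sup>2)" for u e
  have [measurable]: "Q u \<in> borel_measurable (gaussian_vec d S)" for u
    unfolding Q_def[abs_def] by measurable
  have Q_int: "(\<integral>\<^sup>+e. Q u e \<partial>gaussian_vec d S) \<le> ennreal (54 * r\<^sup>2 / u\<^sup>2)" if "0 < u" for u
    using emp_dev_second_moment[OF that] by (simp add: Q_def r_def)
  \<comment> \<open>Each term dominates \<open>K * (\<epsilon> + D)\<close> by the inequality of
    arithmetic and geometric means, weighted with \<open>r\<close>, the order of the root mean
    square of D.\<close>
  define near where "near e = (\<Sum>j<8::nat. ennreal (K * (\<epsilon> + r / 2)) + ennreal (K / (2 * r)) * Q (u0 / 2 ^ j) e)" for e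
  define far where "far e = (\<Sum>k. ennreal (4096 * 2 ^ k) * Q (u0 * 2 ^ k) e)" for e
  have near_meas[measurable]: "near \<in> borel_measurable (gaussian_vec d S)" unfolding near_def[abs_def] by measurable
  have far_meas[measurable]: "far \<in> borel_measurable (gaussian_vec d S)" unfolding far_def[abs_def] by measurable
  have near_le: "(\<integral>\<^sup>+ e. near e \<partial>gaussian_vec d S) \<le> ennreal (8 * K * 27649 * (\<epsilon> + r))"
  proof -
    have "(\<integral>\<^sup>+ e. near e \<partial>gaussian_vec d S) =
        (\<Sum>j<8::nat. ennreal (K * (\<epsilon> + r / 2)) + ennreal (K / (2 * r)) * (\<integral>\<^sup>+e. Q (u0 / 2 ^ j) e \<partial>gaussian_vec d S))"
      unfolding near_def
      by (simp add: nn_integral_sum nn_integral_add nn_integral_cmult G.emeasure_space_1[simplified])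
    also have "\<dots> \<le> (\<Sum>j<8::nat. ennreal (K * 27649 * (\<epsilon> + r)))"
    proof (intro sum_mono)
      fix j :: nat assume "j \<in> {..<8}"
      then have "(2::real) ^ j \<le> 2 ^ 7" by (intro power_increasing) auto
      \<comment> \<open>From \<open>4 / 2 ^ 7 = 1 / 32\<close> comes
        \<open>54 * 32^2 / 2 = 27648\<close>; the remaining \<open>r / 2\<close> is rounded up,
        giving 27649.\<close>
      then have "1 / 32 \<le> u0 / 2 ^ j" using u0 by (simp add: field_simps)
      then have u: "0 < u0 / 2 ^ j" "(1 / 32)\<^sup>2 \<le> (u0 / 2 ^ j)\<^sup>2"
        using u0 by (simp, intro power_mono) auto
      have "(\<integral>\<^sup>+e. Q (u0 / 2 ^ j) e \<partial>gaussian_vec d S) \<le> ennreal (54 * r\<^sup>2 / (u0 / 2 ^ j)\<^sup>2)"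
        by (rule Q_int[OF u(1)])
      also have "\<dots> \<le> ennreal (54 * r\<^sup>2 / (1 / 32)\<^sup>2)"
        using u(2) by (intro ennreal_leI frac_le) auto
      finally have "ennreal (K / (2 * r)) * (\<integral>\<^sup>+e. Q (u0 / 2 ^ j) e \<partial>gaussian_vec d S)
          \<le> ennreal (K / (2 * r)) * ennreal (54 * r\<^sup>2 / (1 / 32)\<^sup>2)"
        by (intro mult_left_mono) auto
      also have "\<dots> = ennreal (K * 27648 * r)"
        using K r by (subst ennreal_mult[symmetric]) (auto simp: power2_eq_square)
      finally have "ennreal (K * (\<epsilon> + r / 2)) + ennreal (K / (2 * r)) * (\<integral>\<^sup>+e. Q (u0 / 2 ^ j) e \<partial>gaussian_vec d S)
          \<le> ennreal (K * (\<epsilon> + r / 2)) + ennreal (K * 27648 * r)"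
        by (intro add_left_mono)
      also have "\<dots> = ennreal (K * (\<epsilon> + r / 2 + 27648 * r))"
        using K r \<epsilon> by (subst ennreal_plus[symmetric]) (auto simp: algebra_simps)
      also have "\<dots> \<le> ennreal (K * (27649 * (\<epsilon> + r)))"
        using K r \<epsilon> by (intro ennreal_leI mult_left_mono) auto
      finally show "ennreal (K * (\<epsilon> + r / 2)) + ennreal (K / (2 * r)) * (\<integral>\<^sup>+e. Q (u0 / 2 ^ j) e \<partial>gaussian_vec d S)
          \<le> ennreal (K * 27649 * (\<epsilon> + r))" by (simp add: mult.assoc)
    qed
    also have "\<dots> = ennreal (8 * K * 27649 * (\<epsilon> + r))"
      using K r \<epsilon> by (subst sum_ennreal) auto
    finally show ?thesis .
  qed
  have far_le: "(\<integral>\<^sup>+ e. far e \<partial>gaussian_vec d S) \<le> ennreal (27649 * (\<epsilon> + r))"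
  proof -
    have "(\<integral>\<^sup>+ e. far e \<partial>gaussian_vec d S) = (\<Sum>k. ennreal (4096 * 2 ^ k) * (\<integral>\<^sup>+e. Q (u0 * 2 ^ k) e \<partial>gaussian_vec d S))"
      unfolding far_def by (simp add: nn_integral_suminf nn_integral_cmult)
    \<comment> \<open>Here \<open>4096 * 54 / 4^2 = 13824\<close>, and \<open>2 ^ k / 4 ^ k\<close>
      leaves a geometric series with sum 2.\<close>
    also have "\<dots> \<le> (\<Sum>k. ennreal (13824 * r * (1 / 2) ^ k))"
    proof (intro suminf_le allI)
      fix k :: nat
      have u: "4 * 2 ^ k \<le> u0 * 2 ^ k" using u0 by (intro mult_right_mono) auto
      then have u': "0 < u0 * 2 ^ k" using u0 by simp
      have "(\<integral>\<^sup>+e. Q (u0 * 2 ^ k) e \<partial>gaussian_vec d S) \<le> ennreal (54 * r\<^sup>2 / (u0 * 2 ^ k)\<^sup>2)"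
        by (rule Q_int[OF u'])
      also have "\<dots> \<le> ennreal (54 * r / (4 * 2 ^ k)\<^sup>2)"
        using r u by (intro ennreal_leI frac_le power_mono) (auto simp: power2_eq_square mult_le_cancel_left1)
      finally have "ennreal (4096 * 2 ^ k) * (\<integral>\<^sup>+e. Q (u0 * 2 ^ k) e \<partial>gaussian_vec d S)
          \<le> ennreal (4096 * 2 ^ k) * ennreal (54 * r / (4 * 2 ^ k)\<^sup>2)"
        by (intro mult_left_mono) auto
      also have "\<dots> = ennreal (13824 * r * (1 / 2) ^ k)"
        using r by (subst ennreal_mult[symmetric]) (auto simp: power2_eq_square power_divide field_simps)
      finally show "ennreal (4096 * 2 ^ k) * (\<integral>\<^sup>+e. Q (u0 * 2 ^ k) e \<partial>gaussian_vec d S)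
          \<le> ennreal (13824 * r * (1 / 2) ^ k)" .
    qed auto
    also have "\<dots> = ennreal (\<Sum>k. 13824 * r * (1 / 2) ^ k)"
      using r by (intro suminf_ennreal2 summable_mult summable_geometric) auto
    also have "(\<Sum>k. 13824 * r * (1 / 2) ^ k) = 27648 * r"
      by (simp add: suminf_mult suminf_geometric summable_geometric)
    also have "ennreal (27648 * r) \<le> ennreal (27649 * (\<epsilon> + r))"
      using r \<epsilon> by (intro ennreal_leI) auto
    finally show ?thesis .
  qed
  have "AE e in gaussian_vec d S. \<forall>i\<in>{..<d}. e i / sqrt (S i i) \<noteq> - \<theta> i / \<sigma> / sqrt (S i i)"
    by (intro AE_finite_allI coord_neq_AE) auto
  then have "AE e in gaussian_vec d S.
     e2ennreal (\<bar>sigma_S_sq d S (\<lambda>i. \<theta> i + \<sigma> * e i) - ereal (\<sigma>\<^sup>2)\<bar> / ereal (\<sigma>\<^sup>2)) \<le> near e + far e"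
  proof (rule AE_mp, intro AE_I2 impI)
    fix e :: "nat \<Rightarrow> real"
    assume ne: "\<forall>i\<in>{..<d}. e i / sqrt (S i i) \<noteq> - \<theta> i / \<sigma> / sqrt (S i i)"
    have nz: "\<theta> i + \<sigma> * e i \<noteq> 0" if "i < d" for i
    proof
      assume "\<theta> i + \<sigma> * e i = 0"
      then have "e i = - \<theta> i / \<sigma>" using \<sigma> by (simp add: field_simps)
      then have "e i / sqrt (S i i) = - \<theta> i / \<sigma> / sqrt (S i i)" by (simp only:)
      then show False using ne that by blast
    qed
    let ?D = "\<lambda>u. \<bar>emp_cdf_sq d S e u - chi2_1_cdf u\<bar>"
    have Q: "Q u e = ennreal ((?D u)\<^sup>2)" for u by (simp add: Q_def emp_dev_def)
    have close: "\<bar>emp_cdf_sq d S (\<lambda>i. \<theta> i + \<sigma> * e i) (\<sigma>\<^sup>2 * u) - emp_cdf_sq d S e u\<bar> \<le> \<epsilon>" for u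
      unfolding \<epsilon>_def by (rule emp_cdf_sq_sparse_shift[OF \<sigma> sp])
    note pw = sigma_S_sq_error_pointwise[where Y="\<lambda>i. \<theta> i + \<sigma> * e i" and S=S and v="\<sigma>\<^sup>2" and Fd="emp_cdf_sq d S e",
        OF d nz diag \<sigma>2 close \<epsilon>(2) l0 u0_def]
    obtain z where z: "\<bar>sigma_S_sq d S (\<lambda>i. \<theta> i + \<sigma> * e i) - ereal (\<sigma>\<^sup>2)\<bar> / ereal (\<sigma>\<^sup>2) = ereal z"
      and cases: "(\<exists>j<8. z \<le> K * (\<epsilon> + ?D (u0 / 2 ^ j))) \<or> (\<exists>k. z \<le> 4096 * 2 ^ k * (?D (u0 * 2 ^ k))\<^sup>2)"
      using pw unfolding K_def[symmetric] by blast
    from cases have "ennreal z \<le> near e + far e"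
    proof
      assume "\<exists>j<8. z \<le> K * (\<epsilon> + ?D (u0 / 2 ^ j))"
      then obtain j where j: "j < 8" "z \<le> K * (\<epsilon> + ?D (u0 / 2 ^ j))" by blast
      define D where "D = ?D (u0 / 2 ^ j)"
      have "0 \<le> (r - D)\<^sup>2" by simp
      then have "D \<le> r / 2 + D\<^sup>2 / (2 * r)"
        using r by (simp add: field_simps power2_eq_square)
      then have "K * (\<epsilon> + D) \<le> K * (\<epsilon> + (r / 2 + D\<^sup>2 / (2 * r)))"
        using K by (intro mult_left_mono) auto
      also have "\<dots> = K * (\<epsilon> + r / 2) + K / (2 * r) * D\<^sup>2" by (simp add: algebra_simps)
      finally have "ennreal z \<le> ennreal (K * (\<epsilon> + r / 2) + K / (2 * r) * D\<^sup>2)"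
        using j by (intro ennreal_leI) (simp add: D_def)
      also have "\<dots> = ennreal (K * (\<epsilon> + r / 2)) + ennreal (K / (2 * r)) * Q (u0 / 2 ^ j) e"
        unfolding Q D_def[symmetric] using K r \<epsilon>
        by (subst ennreal_mult[symmetric], simp_all only: ennreal_plus) auto
      also have "\<dots> \<le> near e"
        unfolding near_def using j(1) by (intro member_le_sum) auto
      also have "\<dots> \<le> near e + far e" by simp
      finally show ?thesis .
    next
      assume "\<exists>k. z \<le> 4096 * 2 ^ k * (?D (u0 * 2 ^ k))\<^sup>2"
      then obtain k where k: "z \<le> 4096 * 2 ^ k * (?D (u0 * 2 ^ k))\<^sup>2" by blast
      have "ennreal z \<le> ennreal (4096 * 2 ^ k) * Q (u0 * 2 ^ k) e"
        unfolding Q by (subst ennreal_mult[symmetric]) (use k in \<open>auto intro: ennreal_leI\<close>)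
      also have "\<dots> \<le> far e"
        unfolding far_def using sum_le_suminf[of "\<lambda>k. ennreal (4096 * 2 ^ k) * Q (u0 * 2 ^ k) e" "{k}"] by simp
      also have "\<dots> \<le> near e + far e" by simp
      finally show ?thesis .
    qed
    then show "e2ennreal (\<bar>sigma_S_sq d S (\<lambda>i. \<theta> i + \<sigma> * e i) - ereal (\<sigma>\<^sup>2)\<bar> / ereal (\<sigma>\<^sup>2)) \<le> near e + far e"
      unfolding z by (simp add: e2ennreal_ereal)
  qed
  then have "(\<integral>\<^sup>+ e. e2ennreal (\<bar>sigma_S_sq d S (\<lambda>i. \<theta> i + \<sigma> * e i) - ereal (\<sigma>\<^sup>2)\<bar> / ereal (\<sigma>\<^sup>2)) \<partial>gaussian_vec d S)
      \<le> (\<integral>\<^sup>+ e. near e + far e \<partial>gaussian_vec d S)"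
    by (rule nn_integral_mono_AE)
  also have "\<dots> = (\<integral>\<^sup>+ e. near e \<partial>gaussian_vec d S) + (\<integral>\<^sup>+ e. far e \<partial>gaussian_vec d S)"
    by (intro nn_integral_add) auto
  also have "\<dots> \<le> ennreal (8 * K * 27649 * (\<epsilon> + r)) + ennreal (27649 * (\<epsilon> + r))"
    by (rule add_mono[OF near_le far_le])
  also have "\<dots> = ennreal ((8 * K + 1) * 27649 * (\<epsilon> + r))"
    using K r \<epsilon> by (subst ennreal_plus[symmetric]) (auto simp: algebra_simps)
  finally show ?thesis
    by (simp only: \<epsilon>_def r_def)
qed

end

theorem theorem5:
  "\<exists>C>0. \<exists>c>0. \<forall>(d::nat) (s::nat) (\<sigma>::real) (\<theta>::nat \<Rightarrow> real) (S::nat \<Rightarrow> nat \<Rightarrow> real) (c_star::real).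
     1 \<le> d \<longrightarrow> 1 \<le> s \<longrightarrow> real s \<le> c * real d \<longrightarrow> 0 < \<sigma> \<longrightarrow>
     l0_norm d \<theta> \<le> s \<longrightarrow>
     is_cov_matrix d S \<longrightarrow> 0 < c_star \<longrightarrow> (\<forall>i<d. c_star \<le> S i i) \<longrightarrow>
     (\<integral>\<^sup>+ e. e2ennreal (\<bar>sigma_S_sq d S (\<lambda>i. \<theta> i + \<sigma> * e i) - ereal (\<sigma>\<^sup>2)\<bar> / ereal (\<sigma>\<^sup>2))
        \<partial>gaussian_vec d S)
     \<le> ennreal (C * (real s / real d + frob_norm_tilde d S / real d))"
proof (rule exI[of _ "(8 * (32 / std_normal_density 4) + 1) * 27649"], rule conjI[rotated],
    rule exI[of _ "1 / 8"], intro conjI allI impI)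
  \<comment> \<open>The summand with factor 8 collects the near levels and the 1 the far ones, each
    with 27649.\<close>
  show "0 < (8 * (32 / std_normal_density 4) + 1) * (27649 :: real)"
    by (simp add: normal_density_pos add_pos_pos)
  fix d s :: nat and \<sigma> c_star :: real and \<theta> :: "nat \<Rightarrow> real" and S :: "nat \<Rightarrow> nat \<Rightarrow> real"
  \<comment> \<open>With \<open>c = 1 / 8\<close> the sparsity shift is at most half of the gap
    between 1/2 and 3/4 that the far levels exploit.\<close>
  assume *: "1 \<le> d" "real s \<le> 1 / 8 * real d" "0 < \<sigma>" "l0_norm d \<theta> \<le> s"
    "is_cov_matrix d S" "0 < c_star" "\<forall>i<d. c_star \<le> S i i"
  interpret gaussian_model d S
    using * by unfold_locales (auto intro: less_le_trans)
  show "(\<integral>\<^sup>+ e. e2ennreal (\<bar>sigma_S_sq d S (\<lambda>i. \<theta> i + \<sigma> * e i) - ereal (\<sigma>\<^sup>2)\<bar> / ereal (\<sigma>\<^sup>2))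
        \<partial>gaussian_vec d S)
     \<le> ennreal ((8 * (32 / std_normal_density 4) + 1) * 27649 * (real s / real d + frob_norm_tilde d S / real d))"
    using * by (intro expected_error_le) auto
qed simp

end
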